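(* Let $\alpha\in\mathbb{R}$. (i) For $\lambda,\rho,\mu\in\mathbb{C}$ with $\operatorname{Re}(\mu-\rho)>\operatorname{Re}\lambda+1>0$, $$\cosh^{\lambda+\rho+1}\alpha\; P_{\lambda+\rho+1}^{-\mu}(\tanh\alpha)=\frac{\Gamma(\mu-\rho)}{\Gamma(1+\lambda)\,\Gamma(\mu-\lambda-\rho-1)}\int_\alpha^\infty P_\rho^{-\mu}(\tanh s)\,\cosh^{\rho+1}s\,(\sinh s-\sinh\alpha)^{\lambda}\,ds.$$ (ii) For $\lambda,\mu,\nu\in\mathbb{C}$ with $\operatorname{Re}\mu>-1$ and $\operatorname{Re}\lambda>-1$, $$\frac{P_\nu^{-\mu-\lambda-1}(\tanh\alpha)}{\cosh^{\mu+\lambda+1}\alpha}=\frac{1}{\Gamma(\lambda+1)}\int_\alpha^\infty \cosh^{-\mu-2}s\;P_\nu^{-\mu}(\tanh s)\,(\tanh s-\tanh\alpha)^{\lambda}\,ds.$$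
   Context: For $x\in(-1,1)$ and $\nu,\mu\in\mathbb{C}$ the Ferrers function of the first kind is $P_\nu^{-\mu}(x)=\left(\frac{1-x}{1+x}\right)^{\mu/2}\frac{F(-\nu,\nu+1;1+\mu;\frac{1-x}{2})}{\Gamma(1+\mu)}$, where $F$ is the Gauss hypergeometric function and $F(a,b;c;z)/\Gamma(c)$ is read as $\sum_k \frac{(a)_k(b)_k}{\Gamma(c+k)k!}z^k$, entire in $c$; it is entire in each of $\nu,\mu$. *)

theory Defs
  imports "HOL-Analysis.Analysis"
begin

text \<open>
  The regularized Gauss hypergeometric function \<open>F(a,b;c;z) / \<Gamma>(c)\<close>, for \<open>norm z < 1\<close>.
  Since \<open>rGamma\<close> is the reciprocal Gamma function (zero at the poles of \<open>\<Gamma>\<close>), the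
  parameter \<open>c\<close> is unrestricted.
\<close>

definition hyp2F1_reg :: "complex \<Rightarrow> complex \<Rightarrow> complex \<Rightarrow> complex \<Rightarrow> complex" where
  "hyp2F1_reg a b c z =
     (\<Sum>k. pochhammer a k * pochhammer b k * rGamma (c + of_nat k) / fact k * z ^ k)"

text \<open>
  The Ferrers function of the first kind \<open>P\<^sub>\<nu>\<^sup>\<kappa>(x)\<close>, meaningful for \<open>-1 < x < 1\<close>.
  The second argument is the upper index itself, so \<open>P\<^sub>\<nu>\<^sup>-\<^sup>\<mu>\<close> is \<open>ferrers_P \<nu> (- \<mu>)\<close>.
  The base of the power is a positive real, so the principal branch is the usual one.
\<close>

definition ferrers_P :: "complex \<Rightarrow> complex \<Rightarrow> real \<Rightarrow> complex" where
  "ferrers_P \<nu> \<kappa> x =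
     complex_of_real ((1 - x) / (1 + x)) powr (- \<kappa> / 2) *
     hyp2F1_reg (- \<nu>) (\<nu> + 1) (1 - \<kappa>) (complex_of_real ((1 - x) / 2))"

lemma ferrers_P_uminus:
  "ferrers_P \<nu> (- \<mu>) x =
     complex_of_real ((1 - x) / (1 + x)) powr (\<mu> / 2) *
     hyp2F1_reg (- \<nu>) (\<nu> + 1) (1 + \<mu>) (complex_of_real ((1 - x) / 2))"
  by (simp add: ferrers_P_def)

end

theory Submission imports Defs begin

text \<open>
  Part (ii): in the variable \<open>v = (tanh s - tanh \<alpha>) / (1 - tanh s)\<close> the hypergeometric series can be
  integrated term by term, each term being a Beta integral over \<open>(0, \<infinity>)\<close>.

  Part (i): with \<open>v = sinh s - sinh \<alpha>\<close> and \<open>G\<^sub>\<rho>(sinh s) = cosh\<^sup>\<rho> s P\<^sub>\<rho>\<^sup>-\<^sup>\<mu>(tanh s)\<close> the claim says that the Weyl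
  fractional integral of order \<open>\<lambda> + 1\<close> maps \<open>G\<^sub>\<rho>\<close> to a multiple of \<open>G\<^bsub>\<rho>+\<lambda>+1\<^esub>\<close>.  For large \<open>y\<close>, Pfaff's and
  a quadratic transformation expand \<open>G\<^sub>\<rho>(y)\<close> in the powers \<open>y powr (\<rho> - \<mu> - 2k)\<close>, and the claim follows
  term by term.  That expansion diverges for small \<open>y\<close>, but \<open>G\<^sub>\<rho>' = - (\<mu> - \<rho>) G\<^bsub>\<rho>-1\<^esub>\<close>, so that the Taylor series
  of \<open>G\<^sub>\<rho>\<close> carries the identity for all degrees \<open>\<rho> - j\<close> from \<open>x\<close> to \<open>x - h\<close>.  The admissible step \<open>h\<close> is
  bounded below on every half-line, so finitely many steps reach any real \<open>x\<close>.
\<close>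

subsection \<open>Integrals over the half-line\<close>

text \<open>Part (i) puts no restriction on \<open>1 + \<mu>\<close>, so the classical formulas are
  needed in regularized form. Pfaff's and the quadratic transformation are both obtained by
  expanding binomial powers and evaluating the resulting finite sums by Chu-Vandermonde, stated with
  \<open>rGamma\<close>.

  A single identity, \<open>Beta_pochhammer\<close>, is used twice in part (i). A factor
  \<open>pochhammer (\<mu> - \<rho>) n\<close> sits in the expansion at infinity (with n = 2k) and
  in the Taylor coefficients (with n = k). Integration against \<open>of_real v powr l\<close>
  contributes a Beta value that turns it into the same factor for degree
  \<open>\<rho> + l + 1\<close>.

  The obstacle in the descent is that the Taylor sum must be exchanged with an integral over an
  infinite range, so pointwise convergence is too weak. The step has to suit all \<open>v\<close>
  and all degrees \<open>\<rho> - j\<close> at once. Hence the hypergeometric series is bounded by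
  an exponential in the size of its parameters: degree \<open>\<rho> - k\<close> at
  \<open>x + v\<close> costs at most C R^k (1 + v)^(-Re (\<mu> - \<rho>)), and every h < 1/R is
  admissible.\<close>

text \<open>Change of variables for absolutely integrable functions, moved to \<open>lborel\<close>.
  That notion refers to Lebesgue measurability, so continuity of \<open>f\<close> and
  \<open>g'\<close> supplies the Borel measurability for the passage back.\<close>

lemma set_integral_subst_Ioi:
  fixes f :: "real \<Rightarrow> complex" and g g' :: "real \<Rightarrow> real"
  assumes der: "\<And>s. s > a \<Longrightarrow> (g has_field_derivative g' s) (at s)"
    and pos: "\<And>s. s > a \<Longrightarrow> g' s > 0"
    and img: "g ` {a<..} = {0<..}"
    and cont: "continuous_on {0<..} f" "continuous_on {a<..} g'"
    and int: "set_integrable lborel {0<..} f"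
  shows "set_integrable lborel {a<..} (\<lambda>s. of_real (g' s) * f (g s))"
    and "(LINT s:{a<..}|lborel. of_real (g' s) * f (g s)) = (LINT v:{0<..}|lborel. f v)"
proof -
  have mono: "g x < g y" if "a < x" "x < y" for x y
    by (rule DERIV_pos_imp_increasing[OF that(2)]) (meson der pos that less_le_trans)
  have inj: "inj_on g {a<..}"
    by (rule inj_onI) (metis greaterThan_iff linorder_less_linear mono order_less_irrefl)
  have cg: "continuous_on {a<..} g"
    by (rule DERIV_continuous_on[where D=g']) (use der DERIV_subset in fastforce)
  have c2: "continuous_on {a<..} (\<lambda>s. of_real (g' s) * f (g s))"
    by (intro continuous_intros cont continuous_on_compose2[OF cont(1) cg]) (use img in auto)
  have m1: "set_borel_measurable lborel {0<..} f"
    using borel_measurable_continuous_on_indicator[OF _ cont(1)]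
    by (simp add: set_borel_measurable_def)
  have m2: "set_borel_measurable lborel {a<..} (\<lambda>s. of_real (g' s) * f (g s))"
    using borel_measurable_continuous_on_indicator[OF _ c2]
    by (simp add: set_borel_measurable_def)
  have abs: "f absolutely_integrable_on {0<..}"
    using int m1 unfolding set_integrable_def set_borel_measurable_def
    by (simp add: integrable_completion)
  define b where "b = integral {0<..} f"
  have "(\<lambda>x. \<bar>g' x\<bar> *\<^sub>R f (g x)) absolutely_integrable_on {a<..} \<and>
          integral {a<..} (\<lambda>x. \<bar>g' x\<bar> *\<^sub>R f (g x)) = b"
    by (subst has_absolute_integral_change_of_variables_real)
      (use der inj img abs in \<open>auto simp: b_def DERIV_subset intro: has_field_derivative_at_within\<close>)
  note b = this
  have eq: "\<bar>g' s\<bar> *\<^sub>R f (g s) = of_real (g' s) * f (g s)" if "s \<in> {a<..}" for s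
    using pos[of s] that by (simp add: scaleR_conv_of_real)
  have 1: "(\<lambda>s. of_real (g' s) * f (g s)) absolutely_integrable_on {a<..}"
    by (rule iffD1[OF set_integrable_cong[OF refl refl eq] conjunct1[OF b]])
  have 2: "integral {a<..} (\<lambda>s. of_real (g' s) * f (g s)) = b"
    by (rule trans[OF Henstock_Kurzweil_Integration.integral_cong[OF eq[symmetric]] conjunct2[OF b]])
  show I: "set_integrable lborel {a<..} (\<lambda>s. of_real (g' s) * f (g s))"
    using 1 m2 unfolding set_integrable_def set_borel_measurable_def
    by (simp add: integrable_completion)
  show "(LINT s:{a<..}|lborel. of_real (g' s) * f (g s)) = (LINT v:{0<..}|lborel. f v)"
    using 2 set_borel_integral_eq_integral(2)[OF I] set_borel_integral_eq_integral(2)[OF int]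
    by (simp add: b_def)
qed

text \<open>The bound separates: the integral of the norm of the n-th term is at most
  \<open>c n\<close> times the integral of \<open>g\<close>, so these integrals are summable and sum
  and integral may be exchanged.\<close>

lemma set_integral_sums_dominated:
  fixes f :: "nat \<Rightarrow> real \<Rightarrow> complex" and g :: "real \<Rightarrow> real"
  assumes A: "A \<in> sets lborel"
    and g: "set_integrable lborel A g"
    and f: "\<And>n. set_borel_measurable lborel A (f n)"
    and le: "\<And>n x. x \<in> A \<Longrightarrow> norm (f n x) \<le> c n * g x"
    and c: "summable c"
  shows "set_integrable lborel A (\<lambda>x. \<Sum>n. f n x)"
    and "(\<lambda>n. LINT x:A|lborel. f n x) sums (LINT x:A|lborel. (\<Sum>n. f n x))"
proof -
  let ?F = "\<lambda>n x. indicator A x *\<^sub>R f n x"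
  have gi: "integrable lborel (\<lambda>x. indicator A x * g x)"
    using g by (simp add: set_integrable_def)
  have bd: "norm (?F n x) \<le> c n * (indicator A x * g x)" for n x
    using le[of x n] by (simp add: indicator_def)
  have int: "integrable lborel (?F n)" for n
  proof (rule Bochner_Integration.integrable_bound[OF integrable_mult_right[OF gi, of "c n"]])
    show "?F n \<in> borel_measurable lborel"
      using f[of n] unfolding set_borel_measurable_def .
    show "AE x in lborel. norm (?F n x) \<le> norm (c n * (indicator A x * g x))"
      by (intro AE_I2 order_trans[OF bd]) simp
  qed
  have sx: "summable (\<lambda>n. norm (?F n x))" for x
    by (rule summable_comparison_test'[OF summable_mult2[OF c, of "indicator A x * g x"], of 0])
      (use bd in auto)
  have s2: "summable (\<lambda>n. LINT x|lborel. norm (?F n x))"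
  proof (rule summable_comparison_test'[OF summable_mult2[OF c, of "LINT x|lborel. indicator A x * g x"], of 0])
    fix n
    have "(LINT x|lborel. norm (?F n x)) \<le> (LINT x|lborel. c n * (indicator A x * g x))"
      by (intro integral_mono integrable_norm int integrable_mult_right gi bd)
    then show "norm (LINT x|lborel. norm (?F n x)) \<le> c n * (LINT x|lborel. indicator A x * g x)"
      by simp
  qed
  have eq: "(\<Sum>n. ?F n x) = indicator A x *\<^sub>R (\<Sum>n. f n x)" for x
    by (simp add: indicator_def)
  show "set_integrable lborel A (\<lambda>x. \<Sum>n. f n x)"
    using integrable_suminf[OF int AE_I2[OF sx] s2] unfolding eq set_integrable_def .
  show "(\<lambda>n. LINT x:A|lborel. f n x) sums (LINT x:A|lborel. (\<Sum>n. f n x))"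
    using sums_integral[OF int AE_I2[OF sx] s2] unfolding eq set_lebesgue_integral_def .
qed

lemma Gamma_integral_scaled:
  assumes c: "Re c > 0" and s: "(s::real) > 0"
  shows "set_integrable lborel {0<..} (\<lambda>u. of_real u powr (c - 1) * of_real (exp (- s * u)))"
    and "(LINT u:{0<..}|lborel. of_real u powr (c - 1) * of_real (exp (- s * u))) = Gamma c * of_real s powr (-c)"
proof -
  let ?f = "\<lambda>t. complex_of_real t powr (c - 1) / of_real (exp t)"
  have cont: "continuous_on {0<..} ?f" by (intro continuous_intros) auto
  have abs: "?f absolutely_integrable_on {0<..}"
    by (rule absolutely_integrable_Gamma_integral'[OF c])
  have int: "set_integrable lborel {0<..} ?f"
    using abs borel_measurable_continuous_on_indicator[OF _ cont] unfolding set_integrable_def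
    by (simp add: integrable_completion)
  have G: "(LINT t:{0<..}|lborel. ?f t) = Gamma c"
    using set_borel_integral_eq_integral(2)[OF int] integral_unique[OF Gamma_integral_complex'[OF c]] by simp
  have img: "(\<lambda>u. s * u) ` {0<..} = {0<..}"
  proof safe
    fix x :: real assume "x > 0"
    then show "x \<in> (\<lambda>u. s * u) ` {0<..}" using s by (intro image_eqI[of _ _ "x / s"]) auto
  qed (use s in auto)
  note sub = set_integral_subst_Ioi[of 0 "\<lambda>u. s * u" "\<lambda>_. s", OF _ _ img cont _ int]
  have eq: "of_real s powr (-c) * (of_real s * ?f (s * u)) = of_real u powr (c - 1) * of_real (exp (- s * u))"
    if "u \<in> {0<..}" for u
    using that s by (simp add: powr_times_real powr_diff powr_minus exp_minus field_simps)
  have 1: "set_integrable lborel {0<..} (\<lambda>u. of_real s powr (-c) * (of_real s * ?f (s * u)))"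
    by (intro set_integrable_mult_right sub) (use s in \<open>auto intro!: derivative_eq_intros\<close>)
  then show "set_integrable lborel {0<..} (\<lambda>u. of_real u powr (c - 1) * of_real (exp (- s * u)))"
    by (subst (asm) set_integrable_cong[OF refl refl eq]) auto
  have "(LINT u:{0<..}|lborel. of_real u powr (c - 1) * of_real (exp (- s * u)))
     = (LINT u:{0<..}|lborel. of_real s powr (-c) * (of_real s * ?f (s * u)))"
    by (rule set_lebesgue_integral_cong) (use eq in auto)
  also have "\<dots> = of_real s powr (-c) * (LINT u:{0<..}|lborel. (of_real s * ?f (s * u)))"
    by (rule set_integral_mult_right)
  also have "(LINT u:{0<..}|lborel. (of_real s * ?f (s * u))) = Gamma c"
    unfolding G[symmetric] by (rule sub) (use s in \<open>auto intro!: derivative_eq_intros\<close>)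
  finally show "(LINT u:{0<..}|lborel. of_real u powr (c - 1) * of_real (exp (- s * u))) = Gamma c * of_real s powr (-c)"
    by simp
qed

text \<open>Serves to integrate the norm of the kernel in the Fubini argument below.\<close>

lemma Gamma_integral_scaled_real:
  assumes c: "c > 0" and s: "(s::real) > 0"
  shows "set_integrable lborel {0<..} (\<lambda>u. u powr (c - 1) * exp (- s * u))"
    and "(LINT u:{0<..}|lborel. u powr (c - 1) * exp (- s * u)) = Gamma c * s powr (-c)"
proof -
  have eq: "indicator {0<..} u *\<^sub>R (of_real u powr (of_real c - 1) * complex_of_real (exp (- s * u)))
     = of_real (indicator {0<..} u *\<^sub>R (u powr (c - 1) * exp (- s * u)))" for u
    by (auto simp: indicator_def powr_of_real[symmetric])
  note G = Gamma_integral_scaled[of "of_real c", OF _ s, unfolded set_integrable_def set_lebesgue_integral_def eq]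
  show "set_integrable lborel {0<..} (\<lambda>u. u powr (c - 1) * exp (- s * u))"
    using integrable_bounded_linear[OF bounded_linear_Re G(1)] c unfolding set_integrable_def by simp
  have "complex_of_real (LINT u|lborel. indicator {0<..} u *\<^sub>R (u powr (c - 1) * exp (- s * u))) = of_real (Gamma c * s powr (-c))"
    unfolding integral_complex_of_real[symmetric] using G(2) c s
    by (simp add: Gamma_complex_of_real powr_of_real less_imp_le del: integral_complex_of_real flip: of_real_minus)
  then show "(LINT u:{0<..}|lborel. u powr (c - 1) * exp (- s * u)) = Gamma c * s powr (-c)"
    unfolding of_real_eq_iff set_lebesgue_integral_def .
qed

text \<open>Writing \<open>(x + v) powr (-a)\<close> as a Gamma integral reduces this Beta integral to Fubini's theorem.\<close>

lemma Beta_integral_Ioi: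
  assumes x: "(x::real) > 0" and l: "Re l > -1" and a: "Re a > Re l + 1"
  shows "set_integrable lborel {0<..} (\<lambda>v. of_real (x + v) powr (-a) * of_real v powr l)"
    and "(LINT v:{0<..}|lborel. of_real (x + v) powr (-a) * of_real v powr l)
       = Beta (l + 1) (a - l - 1) * of_real x powr (l + 1 - a)"
proof -
  \<comment> \<open>Integrating out \<open>u\<close> gives \<open>Gamma a\<close> times the
    integrand of the claim; integrating out \<open>v\<close> gives \<open>Gamma (l + 1)\<close>
    times a Gamma integrand with exponent \<open>a - l - 1\<close>.\<close>
  define K where "K = (\<lambda>(u, v). indicator {0<..} u *\<^sub>R indicator {0<..} v *\<^sub>R
     (of_real u powr (a - 1) * of_real v powr l * complex_of_real (exp (- (x + v) * u))))"
  have K_meas: "K \<in> borel_measurable (lborel \<Otimes>\<^sub>M lborel)"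
  proof -
    have "(\<lambda>p. indicator ({0<..} \<times> {0<..}) p *\<^sub>R
       (of_real (fst p) powr (a - 1) * of_real (snd p) powr l * complex_of_real (exp (- (x + snd p) * fst p))))
       \<in> borel_measurable borel"
      by (intro borel_measurable_continuous_on_indicator continuous_intros) 
        (auto simp: borel_prod[symmetric] pair_measureI)
    also have "(\<lambda>p. indicator ({0<..} \<times> {0<..}) p *\<^sub>R
       (of_real (fst p) powr (a - 1) * of_real (snd p) powr l * complex_of_real (exp (- (x + snd p) * fst p)))) = K"
      by (auto simp: K_def indicator_def fun_eq_iff)
    finally show ?thesis by (simp add: borel_prod lborel_prod)
  qed
  have inner_v: "integrable lborel (\<lambda>v. K (u, v))"
    "(LINT v|lborel. K (u, v)) = indicator {0<..} u *\<^sub>R (Gamma (l + 1) * (of_real u powr (a - l - 1 - 1) * of_real (exp (- x * u))))"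
    for u
  proof -
    have eq: "K (u, v) = (indicator {0<..} u *\<^sub>R (of_real u powr (a - 1) * of_real (exp (- x * u)))) *
       (indicator {0<..} v *\<^sub>R (of_real v powr (l + 1 - 1) * complex_of_real (exp (- u * v))))" for v
      by (auto simp: K_def indicator_def exp_add[symmetric] algebra_simps simp flip: of_real_mult)
    note G = Gamma_integral_scaled[of "l + 1" u, unfolded set_integrable_def set_lebesgue_integral_def]
    show "integrable lborel (\<lambda>v. K (u, v))"
    proof (cases "u > 0")
      case True
      then show ?thesis unfolding eq using G(1) l by (intro integrable_mult_right) auto
    qed (simp add: K_def)
    show "(LINT v|lborel. K (u, v)) = indicator {0<..} u *\<^sub>R (Gamma (l + 1) * (of_real u powr (a - l - 1 - 1) * of_real (exp (- x * u))))"
    proof (cases "u > 0")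
      case True
      have "Gamma (l + 1) * (of_real u powr (a - 1) * of_real (exp (- x * u)) * of_real u powr - (l + 1))
        = Gamma (l + 1) * (of_real u powr (a - l - 1 - 1) * of_real (exp (- x * u)))"
        by (simp add: powr_diff powr_add powr_minus field_simps power2_eq_square)
      moreover have "(LINT v|lborel. indicator {0<..} v *\<^sub>R (of_real v powr (l + 1 - 1) * complex_of_real (exp (- u * v))))
         = Gamma (l + 1) * of_real u powr - (l + 1)"
        using G(2)[OF _ True] l by (simp del: add_diff_cancel_right')
      ultimately show ?thesis unfolding eq integral_mult_right_zero using True by (simp add: mult_ac)
    qed (simp add: K_def)
  qed
  have norm_v: "(LINT v|lborel. norm (K (u, v))) = indicator {0<..} u *\<^sub>R (Gamma (Re l + 1) * (u powr (Re a - Re l - 1 - 1) * exp (- x * u)))"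
    for u
  proof (cases "u > 0")
    case True
    have eq: "norm (K (u, v)) = (u powr (Re a - 1) * exp (- x * u)) *
       (indicator {0<..} v *\<^sub>R (v powr (Re l + 1 - 1) * (exp (- u * v))))" for v
      using True by (auto simp: K_def indicator_def norm_mult norm_powr_real_powr exp_add[symmetric] algebra_simps simp del: exp_add)
    show ?thesis using Gamma_integral_scaled_real(2)[of "Re l + 1" u] l True
      unfolding eq integral_mult_right_zero set_lebesgue_integral_def
      by (simp add: powr_diff powr_add powr_minus field_simps power2_eq_square)
  qed (simp add: K_def)
  \<comment> \<open>With \<open>v\<close> integrated out, the norm of \<open>K\<close> becomes a
    real Gamma integrand with exponent \<open>Re a - Re l - 1\<close>, which is positive by the
    hypothesis on \<open>a\<close>.\<close>
  have int_K: "integrable (lborel \<Otimes>\<^sub>M lborel) K"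
  proof (rule lborel_pair.Fubini_integrable[OF K_meas _ AE_I2[OF inner_v(1)]])
    show "integrable lborel (\<lambda>u. LINT v|lborel. norm (K (u, v)))"
      unfolding norm_v using set_integrable_mult_right[OF Gamma_integral_scaled_real(1)[of "Re a - Re l - 1" x]] a x
      by (simp add: set_integrable_def)
  qed
  have inner_u: "(LINT u|lborel. K (u, v)) = indicator {0<..} v *\<^sub>R (Gamma a * (of_real (x + v) powr (-a) * of_real v powr l))" for v
  proof (cases "v > 0")
    case True
    have eq: "K (u, v) = of_real v powr l *
       (indicator {0<..} u *\<^sub>R (of_real u powr (a - 1) * complex_of_real (exp (- (x + v) * u))))" for u
      using True by (auto simp: K_def indicator_def)
    show ?thesis
      using Gamma_integral_scaled(2)[of a "x + v"] True x a l
      unfolding eq integral_mult_right_zero set_lebesgue_integral_def by simp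
  qed (simp add: K_def)
  have Ga: "Gamma a \<noteq> 0" using a l by (auto simp: Gamma_eq_zero_iff elim!: nonpos_Ints_cases)
  have "integrable lborel (\<lambda>v. LINT u|lborel. K (u, v))"
    using lborel_pair.integrable_snd[of "\<lambda>u v. K (u, v)"] int_K by simp
  then have "set_integrable lborel {0<..} (\<lambda>v. Gamma a * (of_real (x + v) powr (-a) * of_real v powr l))"
    unfolding inner_u set_integrable_def .
  then show "set_integrable lborel {0<..} (\<lambda>v. of_real (x + v) powr (-a) * of_real v powr l)"
    by (rule iffD1[OF set_integrable_mult_right_iff[OF Ga]])
  have "Gamma a * (LINT v:{0<..}|lborel. of_real (x + v) powr (-a) * of_real v powr l) = (LINT v|lborel. LINT u|lborel. K (u, v))"
    unfolding set_integral_mult_right[symmetric] unfolding inner_u set_lebesgue_integral_def ..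
  also have "\<dots> = (LINT u|lborel. LINT v|lborel. K (u, v))"
    using lborel_pair.Fubini_integral[of "\<lambda>u v. K (u, v)"] int_K by simp
  also have "\<dots> = (LINT u:{0<..}|lborel. Gamma (l + 1) * (of_real u powr (a - l - 1 - 1) * of_real (exp (- x * u))))"
    unfolding inner_v set_lebesgue_integral_def ..
  also have "\<dots> = Gamma (l + 1) * (Gamma (a - l - 1) * of_real x powr (l + 1 - a))"
    unfolding set_integral_mult_right using Gamma_integral_scaled(2)[of "a - l - 1" x] a x by (simp add: algebra_simps)
  finally show "(LINT v:{0<..}|lborel. of_real (x + v) powr (-a) * of_real v powr l)
       = Beta (l + 1) (a - l - 1) * of_real x powr (l + 1 - a)"
    using Ga by (simp add: Beta_def field_simps)
qed

subsection \<open>The regularized hypergeometric series\<close>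

lemma pochhammer_ge_0: "0 \<le> (x::real) \<Longrightarrow> 0 \<le> pochhammer x n"
  by (simp add: pochhammer_prod prod_nonneg)

lemma norm_pochhammer_le:
  fixes a :: complex
  assumes "norm a \<le> r"
  shows "norm (pochhammer a n) \<le> pochhammer r n"
proof (induction n)
  case (Suc n)
  have r: "0 \<le> r" using assms norm_ge_zero order_trans by blast
  have "norm (a + of_nat n) \<le> r + real n"
    using norm_triangle_ineq[of a "of_nat n"] assms by simp
  then show ?case using Suc r unfolding pochhammer_rec' norm_mult
    by (intro mult_mono) auto
qed simp

lemma pochhammer_binomial_sums:
  fixes z a :: complex
  assumes "norm z < 1"
  shows "(\<lambda>j. pochhammer a j / fact j * z ^ j) sums (1 - z) powr (- a)"
proof -
  have "((- a) gchoose j) * (- z) ^ j = pochhammer a j / fact j * z ^ j" for j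
    by (simp add: gbinomial_pochhammer power_minus[of z] mult_ac flip: power_add mult_2)
  then show ?thesis using gen_binomial_complex[of "- z" "- a"] assms by simp
qed

lemma pochhammer_binomial_sums_real:
  fixes x r :: real
  assumes "\<bar>x\<bar> < 1"
  shows "(\<lambda>j. pochhammer r j / fact j * x ^ j) sums (1 - x) powr (- r)"
proof -
  have "((- r) gchoose j) * (- x) ^ j = pochhammer r j / fact j * x ^ j" for j
    by (simp add: gbinomial_pochhammer power_minus[of x] mult_ac flip: power_add mult_2)
  then show ?thesis using gen_binomial_real[of "- x" "- r"] assms by simp
qed

lemma pochhammer_binomial_term_le:
  fixes x r :: real
  assumes "0 \<le> x" "x < 1" "0 \<le> r"
  shows "pochhammer r j / fact j * x ^ j \<le> (1 - x) powr (- r)"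
proof -
  have "(\<Sum>i\<in>{j}. pochhammer r i / fact i * x ^ i) \<le> (\<Sum>i. pochhammer r i / fact i * x ^ i)"
    using pochhammer_binomial_sums_real[of x r] assms
    by (intro sum_le_suminf) (auto simp: sums_iff pochhammer_ge_0)
  then show ?thesis using pochhammer_binomial_sums_real[of x r] assms by (simp add: sums_iff)
qed

text \<open>By the functional equation consecutive values have ratio (j + 1) \<theta> / |c + j|,
  which tends to \<theta> < 1, so the sequence is eventually non-increasing. Poles of Gamma cause no
  trouble, since only \<open>rGamma\<close> occurs.\<close>

lemma rGamma_shift_bound:
  fixes c :: complex and \<theta> :: real
  assumes \<theta>: "0 < \<theta>" "\<theta> < 1"
  obtains C where "C > 0" "\<And>j. norm (rGamma (c + of_nat j)) * fact j * \<theta> ^ j \<le> C"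
proof -
  define u where "u j = norm (rGamma (c + of_nat j)) * fact j * \<theta> ^ j" for j :: nat
  \<comment> \<open>Solves (j + 1) \<theta> \<le> j - |c| for j; from there on the ratio is at most
    1.\<close>
  define N where "N = nat \<lceil>(\<theta> + norm c) / (1 - \<theta>)\<rceil>"
  have u0: "u j \<ge> 0" for j using \<theta> by (simp add: u_def)
  have step: "u (Suc j) \<le> u j" if "j \<ge> N" for j
  proof -
    have "(\<theta> + norm c) / (1 - \<theta>) \<le> real j" using that unfolding N_def by linarith
    then have "(real j + 1) * \<theta> \<le> real j - norm c" using \<theta> by (simp add: field_simps)
    also have "\<dots> \<le> norm (c + of_nat j)"
      using norm_triangle_ineq2[of "of_nat j" "- c"] by (simp add: add.commute)
    finally have le: "(real j + 1) * \<theta> \<le> norm (c + of_nat j)" .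
    have "rGamma (c + of_nat j) = (c + of_nat j) * rGamma (c + of_nat (Suc j))"
      using rGamma_plus1[of "c + of_nat j"] by (simp add: add_ac)
    then have "u j = norm (c + of_nat j) * (norm (rGamma (c + of_nat (Suc j))) * fact j * \<theta> ^ j)"
      by (simp add: u_def norm_mult)
    also have "\<dots> \<ge> ((real j + 1) * \<theta>) * (norm (rGamma (c + of_nat (Suc j))) * fact j * \<theta> ^ j)"
      using le \<theta> by (intro mult_right_mono) auto
    finally show ?thesis by (simp add: u_def mult_ac add_ac)
  qed
  have "u j \<le> (\<Sum>i\<le>N. u i)" for j
  proof (cases "j \<le> N")
    case True
    then show ?thesis using member_le_sum[of j "{..N}" u] u0 by auto
  next
    case False
    then have "N \<le> j" by simp
    then have "u j \<le> u N"
    proof (induction rule: dec_induct)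
      case (step i)
      then show ?case using \<open>\<And>j. N \<le> j \<Longrightarrow> u (Suc j) \<le> u j\<close>[of i] by linarith
    qed simp
    also have "\<dots> \<le> (\<Sum>i\<le>N. u i)" using member_le_sum[of N "{..N}" u] u0 by auto
    finally show ?thesis .
  qed
  then have "u j \<le> (\<Sum>i\<le>N. u i) + 1" for j by (smt (verit))
  moreover have "(\<Sum>i\<le>N. u i) + 1 > 0" using sum_nonneg[of "{..N}" u] u0 by (smt (verit))
  ultimately show ?thesis using that unfolding u_def by blast
qed

definition hyp_coeff :: "complex \<Rightarrow> complex \<Rightarrow> complex \<Rightarrow> nat \<Rightarrow> complex" where
  "hyp_coeff a b c k = pochhammer a k * pochhammer b k * rGamma (c + of_nat k) / fact k"

lemma hyp2F1_reg_eq: "hyp2F1_reg a b c z = (\<Sum>k. hyp_coeff a b c k * z ^ k)"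
  by (simp add: hyp2F1_reg_def hyp_coeff_def)

text \<open>\<open>rGamma (c + of_nat j)\<close> is O(1 / (j! \<theta>^j)), so the coefficient is
  essentially a product of two binomial coefficients. The order of quantifiers matters:
  \<open>C\<close> and \<open>\<omega>\<close> depend on \<open>c\<close> and \<open>\<zeta>\<close>
  only, not on \<open>a\<close>, \<open>b\<close> or \<open>r\<close>.\<close>

lemma hyp_coeff_bound:
  assumes \<zeta>: "0 \<le> \<zeta>" "\<zeta> < 1"
  obtains C \<omega> where "C > 0" "0 \<le> \<omega>" "\<omega> < 1"
    "\<And>r a b j. norm a \<le> r \<Longrightarrow> norm b \<le> r \<Longrightarrow>
       norm (hyp_coeff a b c j) * \<zeta> ^ j \<le> C * (pochhammer r j / fact j * \<omega> ^ j)\<^sup>2"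
proof -
  \<comment> \<open>Any value strictly between \<zeta> and 1 would do; it leaves \<omega>^2 =
    \<zeta> / \<theta> < 1.\<close>
  define \<theta> where "\<theta> = (1 + \<zeta>) / 2"
  define \<omega> where "\<omega> = sqrt (\<zeta> / \<theta>)"
  have \<theta>: "0 < \<theta>" "\<theta> < 1" "\<zeta> < \<theta>" using \<zeta> by (auto simp: \<theta>_def)
  obtain C where C: "C > 0" "\<And>j. norm (rGamma (c + of_nat j)) * fact j * \<theta> ^ j \<le> C"
    using rGamma_shift_bound[OF \<theta>(1,2)] by blast
  have \<omega>: "0 \<le> \<omega>" "\<omega> < 1" using \<zeta> \<theta> by (auto simp: \<omega>_def)
  have \<omega>2: "\<omega>\<^sup>2 * \<theta> = \<zeta>" using \<zeta> \<theta> by (simp add: \<omega>_def)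
  have "norm (hyp_coeff a b c j) * \<zeta> ^ j \<le> C * (pochhammer r j / fact j * \<omega> ^ j)\<^sup>2"
    if "norm a \<le> r" "norm b \<le> r" for r a b j
  proof -
    have r: "0 \<le> r" using that(1) norm_ge_zero order_trans by blast
    have "norm (hyp_coeff a b c j) * \<zeta> ^ j
        = norm (pochhammer a j) * norm (pochhammer b j) * (norm (rGamma (c + of_nat j)) * fact j * \<theta> ^ j) * ((\<omega> ^ j)\<^sup>2 / (fact j)\<^sup>2)"
      unfolding \<omega>2[symmetric]
      by (simp add: hyp_coeff_def norm_mult norm_divide power_mult_distrib power2_eq_square field_simps)
    also have "\<dots> \<le> pochhammer r j * pochhammer r j * C * ((\<omega> ^ j)\<^sup>2 / (fact j)\<^sup>2)"
      using that r \<theta> C(1) by (intro mult_mono norm_pochhammer_le C) (auto simp: pochhammer_ge_0)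
    finally show ?thesis by (simp add: power2_eq_square field_simps)
  qed
  with C \<omega> that show ?thesis by blast
qed

text \<open>Each term of the nonnegative binomial series is at most its sum S, so the squares sum to
  at most S^2. What matters is that this is exponential in \<open>r\<close>.\<close>

lemma pochhammer_binomial_square_summable:
  fixes \<omega> r :: real
  assumes "0 \<le> \<omega>" "\<omega> < 1" "0 \<le> r"
  shows "summable (\<lambda>j. (pochhammer r j / fact j * \<omega> ^ j)\<^sup>2)"
    and "(\<Sum>j. (pochhammer r j / fact j * \<omega> ^ j)\<^sup>2) \<le> (1 - \<omega>) powr (- (2 * r))"
proof -
  define t where "t j = pochhammer r j / fact j * \<omega> ^ j" for j :: nat
  define S where "S = (1 - \<omega>) powr (- r)"
  have t: "t sums S" using pochhammer_binomial_sums_real[of \<omega> r] assms unfolding t_def S_def by simp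
  have t0: "t j \<ge> 0" for j using assms by (auto simp: t_def pochhammer_ge_0)
  have le: "(t j)\<^sup>2 \<le> S * t j" for j
    using pochhammer_binomial_term_le[of \<omega> r j] assms t0[of j] unfolding power2_eq_square t_def S_def
    by (intro mult_right_mono) auto
  have sm: "summable (\<lambda>j. S * t j)" using t by (auto simp: sums_iff)
  show 1: "summable (\<lambda>j. (pochhammer r j / fact j * \<omega> ^ j)\<^sup>2)"
    using summable_comparison_test'[OF sm, of 0 "\<lambda>j. (t j)\<^sup>2"] le unfolding t_def by simp
  have "(\<Sum>j. (t j)\<^sup>2) \<le> (\<Sum>j. S * t j)"
    using 1 le sm unfolding t_def[symmetric] by (intro suminf_le) auto
  also have "\<dots> = S * S" using t by (simp add: sums_iff suminf_mult)
  also have "\<dots> = (1 - \<omega>) powr (- (2 * r))" by (simp add: S_def flip: powr_add)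
  finally show "(\<Sum>j. (pochhammer r j / fact j * \<omega> ^ j)\<^sup>2) \<le> (1 - \<omega>) powr (- (2 * r))"
    unfolding t_def .
qed

lemma hyp_coeff_summable:
  assumes "0 \<le> x" "x < 1"
  shows "summable (\<lambda>j. norm (hyp_coeff a b c j) * x ^ j)"
proof -
  obtain C \<omega> where C: "C > 0" "0 \<le> \<omega>" "\<omega> < 1"
    "\<And>r a b j. norm a \<le> r \<Longrightarrow> norm b \<le> r \<Longrightarrow>
       norm (hyp_coeff a b c j) * x ^ j \<le> C * (pochhammer r j / fact j * \<omega> ^ j)\<^sup>2"
    by (rule hyp_coeff_bound[OF assms, of c]) (rule that)
  define r where "r = max (norm a) (norm b)"
  have "0 \<le> r" by (simp add: r_def le_max_iff_disj)
  note sm = summable_mult[OF pochhammer_binomial_square_summable(1)[OF C(2,3) this], of C]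
  show ?thesis
    by (rule summable_comparison_test'[OF sm, of 0]) (use C(4)[of a r b] assms in \<open>auto simp: r_def\<close>)
qed

lemma hyp2F1_reg_summable:
  assumes "norm z < 1"
  shows "summable (\<lambda>j. hyp_coeff a b c j * z ^ j)"
  using hyp_coeff_summable[of "norm z" a b c] assms
  by - (rule summable_norm_cancel, simp add: norm_mult norm_power)

text \<open>The source of the geometric factor in the descent: lowering the degree k times raises
  the admissible \<open>r\<close> by k, hence the bound by the factor R^k.\<close>

lemma hyp2F1_reg_bound:
  assumes \<zeta>: "0 \<le> \<zeta>" "\<zeta> < 1"
  obtains C R where "C > 0" "R \<ge> 1"
    "\<And>r a b z. norm a \<le> r \<Longrightarrow> norm b \<le> r \<Longrightarrow> norm z \<le> \<zeta> \<Longrightarrow>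
       norm (hyp2F1_reg a b c z) \<le> C * R powr r"
proof -
  obtain C \<omega> where C: "C > 0" "0 \<le> \<omega>" "\<omega> < 1"
    "\<And>r a b j. norm a \<le> r \<Longrightarrow> norm b \<le> r \<Longrightarrow>
       norm (hyp_coeff a b c j) * \<zeta> ^ j \<le> C * (pochhammer r j / fact j * \<omega> ^ j)\<^sup>2"
    by (rule hyp_coeff_bound[OF assms, of c]) (rule that)
  define R where "R = (1 - \<omega>) powr (- 2)"
  have "(1 - \<omega>)\<^sup>2 \<le> 1" using C by (intro power_le_one) auto
  then have R: "R \<ge> 1" using C by (simp add: R_def powr_minus field_simps)
  have "norm (hyp2F1_reg a b c z) \<le> C * R powr r" if ab: "norm a \<le> r" "norm b \<le> r" and z: "norm z \<le> \<zeta>" for r a b z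
  proof -
    have r: "0 \<le> r" using ab(1) norm_ge_zero order_trans by blast
    note sq = pochhammer_binomial_square_summable[OF C(2,3) r]
    have sm: "summable (\<lambda>j. norm (hyp_coeff a b c j * z ^ j))"
      using hyp_coeff_summable[of "norm z" a b c] z \<zeta> by (simp add: norm_mult norm_power)
    have "norm (hyp2F1_reg a b c z) \<le> (\<Sum>j. norm (hyp_coeff a b c j * z ^ j))"
      unfolding hyp2F1_reg_eq by (rule summable_norm[OF sm])
    also have "\<dots> \<le> (\<Sum>j. C * (pochhammer r j / fact j * \<omega> ^ j)\<^sup>2)"
    proof (rule suminf_le[OF _ sm summable_mult[OF sq(1)]])
      fix j
      have "norm (hyp_coeff a b c j * z ^ j) \<le> norm (hyp_coeff a b c j) * \<zeta> ^ j"
        unfolding norm_mult norm_power using z by (intro mult_left_mono power_mono) auto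
      also have "\<dots> \<le> C * (pochhammer r j / fact j * \<omega> ^ j)\<^sup>2" by (rule C(4)[OF ab])
      finally show "norm (hyp_coeff a b c j * z ^ j) \<le> C * (pochhammer r j / fact j * \<omega> ^ j)\<^sup>2" .
    qed
    also have "\<dots> = C * (\<Sum>j. (pochhammer r j / fact j * \<omega> ^ j)\<^sup>2)" by (rule suminf_mult[OF sq(1)])
    also have "\<dots> \<le> C * (1 - \<omega>) powr (- (2 * r))" using sq(2) C by simp
    also have "(1 - \<omega>) powr (- (2 * r)) = R powr r" by (simp add: R_def powr_powr)
    finally show ?thesis .
  qed
  with C(1) R that show ?thesis by blast
qed

lemma has_field_derivative_hyp2F1_reg:
  assumes "norm z < 1"
  shows "(hyp2F1_reg a b c has_field_derivative (\<Sum>k. diffs (hyp_coeff a b c) k * z ^ k)) (at z)"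
  using termdiffs_strong'[of 1 "hyp_coeff a b c" z] hyp2F1_reg_summable assms
  by (simp add: hyp2F1_reg_eq[abs_def])

section \<open>Transformation formulas and the degree-lowering relation\<close>

text \<open>Chu-Vandermonde, F(-n, B; c; 1) = (c - B)_n / (c)_n, divided by Gamma(c) and therefore
  valid for every c. Pascal's rule splits the sum for n + 1 into the sum for (n, B, c) and -B times
  the sum for (n, B + 1, c + 1), whence the induction over arbitrary \<open>B\<close> and
  \<open>c\<close>.\<close>

lemma chu_vandermonde_rGamma:
  fixes B c :: complex
  shows "(\<Sum>k\<le>n. of_nat (n choose k) * ((-1) ^ k * pochhammer B k * rGamma (c + of_nat k)))
     = pochhammer (c - B) n * rGamma (c + of_nat n)"
proof (induction n arbitrary: B c)
  case (Suc n)
  define t where "t k = (-1) ^ k * pochhammer B k * rGamma (c + of_nat k)" for k :: nat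
  have "(\<Sum>k\<le>Suc n. of_nat (Suc n choose k) * t k)
      = t 0 + (\<Sum>k\<le>n. of_nat (n choose k) * t (Suc k)) + (\<Sum>k\<le>n. of_nat (n choose Suc k) * t (Suc k))"
    by (simp add: sum.atMost_Suc_shift algebra_simps sum.distrib del: sum.atMost_Suc)
  also have "t 0 + (\<Sum>k\<le>n. of_nat (n choose k) * t (Suc k)) + (\<Sum>k\<le>n. of_nat (n choose Suc k) * t (Suc k))
     = (\<Sum>k\<le>Suc n. of_nat (n choose k) * t k) + (\<Sum>k\<le>n. of_nat (n choose k) * t (Suc k))"
    unfolding sum.atMost_Suc_shift[of "\<lambda>k. of_nat (n choose k) * t k"] by simp
  also have "(\<Sum>k\<le>Suc n. of_nat (n choose k) * t k) = (\<Sum>k\<le>n. of_nat (n choose k) * t k)"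
    by simp
  also have "\<dots> = pochhammer (c - B) n * rGamma (c + of_nat n)"
    unfolding t_def by (rule Suc.IH)
  also have "(\<Sum>k\<le>n. of_nat (n choose k) * t (Suc k))
     = - B * (\<Sum>k\<le>n. of_nat (n choose k) * ((-1) ^ k * pochhammer (B + 1) k * rGamma (c + 1 + of_nat k)))"
    unfolding sum_distrib_left t_def by (intro sum.cong) (auto simp: pochhammer_rec mult_ac add_ac)
  also have "\<dots> = - B * (pochhammer (c - B) n * rGamma (c + 1 + of_nat n))"
    by (subst Suc.IH) simp
  also have "rGamma (c + of_nat n) = (c + of_nat n) * rGamma (c + 1 + of_nat n)"
    using rGamma_plus1[of "c + of_nat n"] by (simp add: add_ac)
  finally show ?case
    unfolding t_def by (simp add: pochhammer_rec' algebra_simps)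
qed simp

text \<open>Expand each power of 1 - z into its binomial series and collect the double series by the
  total power n = k + j. The summability hypothesis is absolute convergence of a majorant of the
  double series, with the inner sum already evaluated. Pfaff's transformation is the case m = 1, the
  quadratic one m = 2.\<close>

lemma binomial_transform_sums:
  fixes b :: "nat \<Rightarrow> complex" and A z :: complex and m :: nat
  assumes z: "norm z < 1"
    and sm: "summable (\<lambda>k. norm (b k) * norm z ^ k * (1 - norm z) powr (- (norm A + real (m * k))))"
  shows "(\<lambda>n. z ^ n * (\<Sum>k\<le>n. (-1) ^ k * b k * pochhammer (A + of_nat (m * k)) (n - k) / fact (n - k)))
     sums (\<Sum>k. b k * (- z) ^ k * (1 - z) powr (- (A + of_nat (m * k))))"
proof -
  define F where "F = (\<lambda>(k, j). b k * (- z) ^ k * (pochhammer (A + of_nat (m * k)) j / fact j * z ^ j))"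
  define N where "N = (\<lambda>(k, j). norm (b k) * norm z ^ k * (pochhammer (norm A + real (m * k)) j / fact j * norm z ^ j))"
  have le: "norm (F p) \<le> N p" for p
  proof (cases p)
    case (Pair k j)
    have "norm (pochhammer (A + of_nat (m * k)) j) \<le> pochhammer (norm A + real (m * k)) j"
      using norm_triangle_ineq[of A "of_nat (m * k)"] unfolding norm_of_nat by (intro norm_pochhammer_le)
    then show ?thesis unfolding Pair F_def N_def
      by (auto simp: norm_mult norm_divide norm_power intro!: mult_left_mono mult_right_mono divide_right_mono)
  qed
  have N0: "N p \<ge> 0" for p
    using le[of p] norm_ge_zero order_trans by blast
  have N_inner: "((\<lambda>j. N (k, j)) has_sum norm (b k) * norm z ^ k * (1 - norm z) powr (- (norm A + real (m * k)))) UNIV" for k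
    using N0 pochhammer_binomial_sums_real[of "norm z" "norm A + real (m * k)"] z unfolding N_def prod.case
    by (intro sums_nonneg_imp_has_sum sums_mult) auto
  have "N summable_on Sigma UNIV (\<lambda>_. UNIV)"
    by (rule summable_on_SigmaI[OF N_inner]) (use sm N0 in \<open>auto simp: summable_on_UNIV_nonneg_real_iff\<close>)
  then have "(\<lambda>p. norm (F p)) summable_on Sigma UNIV (\<lambda>_. UNIV)"
    by (rule summable_on_comparison_test) (use le in auto)
  then have Fs: "F summable_on Sigma UNIV (\<lambda>_. UNIV)" by (rule abs_summable_summable)
  then obtain S where S: "(F has_sum S) (Sigma UNIV (\<lambda>_. UNIV))" by (auto simp: summable_on_def)
  have F_inner: "((\<lambda>j. F (k, j)) has_sum b k * (- z) ^ k * (1 - z) powr (- (A + of_nat (m * k)))) UNIV" for k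
  proof (rule norm_summable_imp_has_sum)
    have "summable (\<lambda>j. N (k, j))" using N_inner[of k] has_sum_imp_sums sums_summable by blast
    then show "summable (\<lambda>j. norm (F (k, j)))" by (rule summable_comparison_test'[of _ 0]) (use le in auto)
    show "(\<lambda>j. F (k, j)) sums (b k * (- z) ^ k * (1 - z) powr (- (A + of_nat (m * k))))"
      unfolding F_def prod.case by (intro sums_mult pochhammer_binomial_sums z)
  qed
  have "(\<lambda>k. b k * (- z) ^ k * (1 - z) powr (- (A + of_nat (m * k)))) sums S"
    by (rule has_sum_imp_sums[OF has_sum_SigmaD[OF S F_inner]])
  then have S_eq: "S = (\<Sum>k. b k * (- z) ^ k * (1 - z) powr (- (A + of_nat (m * k))))"
    by (simp add: sums_iff)
  have bij: "bij_betw (\<lambda>(n, k). (k, n - k)) (Sigma UNIV (\<lambda>n. {..n})) (Sigma UNIV (\<lambda>_. UNIV) :: (nat \<times> nat) set)"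
    by (rule bij_betwI[where g = "\<lambda>(k, j). (k + j, k)"]) auto
  have "((\<lambda>p. F (case p of (n, k) \<Rightarrow> (k, n - k))) has_sum S) (Sigma UNIV (\<lambda>n. {..n}))"
    by (rule iffD2[OF has_sum_reindex_bij_betw[OF bij] S])
  from has_sum_SigmaD[OF this, of "\<lambda>n. \<Sum>k\<le>n. F (k, n - k)"]
  have "(\<lambda>n. \<Sum>k\<le>n. F (k, n - k)) sums S"
    by (intro has_sum_imp_sums) (simp add: has_sum_finite)
  also have "(\<lambda>n. \<Sum>k\<le>n. F (k, n - k)) = (\<lambda>n. z ^ n * (\<Sum>k\<le>n. (-1) ^ k * b k * pochhammer (A + of_nat (m * k)) (n - k) / fact (n - k)))"
  proof
    fix n
    have "F (k, n - k) = z ^ n * ((-1) ^ k * b k * pochhammer (A + of_nat (m * k)) (n - k) / fact (n - k))" if "k \<le> n" for k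
      using that power_add[of z k "n - k"] by (simp add: F_def power_minus[of z] mult_ac)
    then show "(\<Sum>k\<le>n. F (k, n - k)) = z ^ n * (\<Sum>k\<le>n. (-1) ^ k * b k * pochhammer (A + of_nat (m * k)) (n - k) / fact (n - k))"
      unfolding sum_distrib_left by (intro sum.cong) auto
  qed
  finally show ?thesis unfolding S_eq .
qed

lemma hyp2F1_reg_commute: "hyp2F1_reg a b c z = hyp2F1_reg b a c z"
  by (simp add: hyp2F1_reg_def mult_ac)

text \<open>The inner sums of the binomial re-expansion are Chu-Vandermonde sums. Absolute
  convergence of the double series needs |z| / (1 - |z|) < 1, which is the bound 1/2.\<close>

lemma hyp2F1_reg_pfaff:
  assumes z: "norm z < 1 / 2"
  shows "(1 - z) powr (- A) * hyp2F1_reg A B c (- z / (1 - z)) = hyp2F1_reg A (c - B) c z"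
proof -
  let ?b = "hyp_coeff A B c"
  have z1: "norm z < 1" "1 - z \<noteq> 0" using z by auto
  have eq: "norm (?b k) * norm z ^ k * (1 - norm z) powr (- (norm A + real (1 * k)))
      = (1 - norm z) powr (- norm A) * (norm (?b k) * (norm z / (1 - norm z)) ^ k)" for k
    using z1 by (simp add: powr_diff powr_minus powr_realpow powr_add power_divide field_simps)
  have sm: "summable (\<lambda>k. norm (?b k) * norm z ^ k * (1 - norm z) powr (- (norm A + real (1 * k))))"
    unfolding eq using z by (intro summable_mult hyp_coeff_summable) (auto simp: field_simps)
  have coeff: "(\<Sum>k\<le>n. (-1) ^ k * ?b k * pochhammer (A + of_nat (1 * k)) (n - k) / fact (n - k))
      = hyp_coeff A (c - B) c n" for n
  proof -
    have "(-1) ^ k * ?b k * pochhammer (A + of_nat (1 * k)) (n - k) / fact (n - k)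
      = pochhammer A n / fact n * (of_nat (n choose k) * ((-1) ^ k * pochhammer B k * rGamma (c + of_nat k)))"
      if "k \<le> n" for k
      using pochhammer_product[OF that, of A] binomial_fact[OF that, where ?'a = complex]
      by (simp add: hyp_coeff_def field_simps)
    then have "(\<Sum>k\<le>n. (-1) ^ k * ?b k * pochhammer (A + of_nat (1 * k)) (n - k) / fact (n - k))
      = pochhammer A n / fact n * (\<Sum>k\<le>n. of_nat (n choose k) * ((-1) ^ k * pochhammer B k * rGamma (c + of_nat k)))"
      unfolding sum_distrib_left by (intro sum.cong) auto
    then show ?thesis by (simp add: chu_vandermonde_rGamma hyp_coeff_def)
  qed
  have term_eq: "?b k * (- z) ^ k * (1 - z) powr (- (A + of_nat (1 * k)))
      = (1 - z) powr (- A) * (?b k * (- z / (1 - z)) ^ k)" for k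
    using z1 unfolding power_divide by (simp add: powr_diff powr_minus powr_nat' field_simps)
  have "norm z < 1 - norm z" using z by simp
  also have "\<dots> \<le> norm (1 - z)" using norm_triangle_ineq2[of 1 z] by simp
  finally have w: "norm (- z / (1 - z)) < 1" using z1 by (simp add: norm_divide)
  have "hyp2F1_reg A (c - B) c z = (\<Sum>k. ?b k * (- z) ^ k * (1 - z) powr (- (A + of_nat (1 * k))))"
    using binomial_transform_sums[OF z1(1) sm] unfolding coeff by (simp add: sums_iff hyp2F1_reg_eq mult.commute)
  also have "\<dots> = (1 - z) powr (- A) * hyp2F1_reg A B c (- z / (1 - z))"
    unfolding term_eq hyp2F1_reg_eq by (rule suminf_mult[OF hyp2F1_reg_summable[OF w]])
  finally show ?thesis ..
qed

text \<open>Duplication formula; it makes the series of the quadratic transformation hypergeometric,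
  so that the known summability applies.\<close>

lemma pochhammer_even_rGamma:
  "pochhammer a (2 * k) * rGamma (c + of_nat k) / fact k = 4 ^ k * hyp_coeff (a / 2) (a / 2 + 1 / 2) c k"
  using pochhammer_double[of "a / 2" k] by (simp add: hyp_coeff_def power_mult)

text \<open>The classical F(a, b; a - b + 1; z) = (1 + z)^(-a) F(a/2, a/2 + 1/2; a - b + 1; 4z / (1
  + z)^2), with the right side kept as a series in powers of 1 + z because these become powers of
  \<open>sinh s\<close>.\<close>

lemma hyp2F1_reg_quadratic:
  assumes z: "norm z \<le> 1 / 6"
  shows "hyp2F1_reg a b (a - b + 1) z
     = (\<Sum>k. pochhammer a (2 * k) * rGamma (a - b + 1 + of_nat k) / fact k * z ^ k * (1 + z) powr (- (a + of_nat (2 * k))))"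
proof -
  define c where "c = a - b + 1"
  define d where "d k = pochhammer a (2 * k) * rGamma (c + of_nat k) / fact k" for k
  have z1: "norm (- z) < 1" "1 + z \<noteq> 0" using z by (auto simp: add_eq_0_iff)
  \<comment> \<open>The double series converges absolutely if x < 1; at |z| = 1/6 the value of x is
    24/25.\<close>
  define x where "x = 4 * norm z / (1 - norm z)\<^sup>2"
  have x: "0 \<le> x" "x < 1"
  proof -
    have "(5 / 6)\<^sup>2 \<le> (1 - norm z)\<^sup>2" using z by (intro power_mono) auto
    then show "0 \<le> x" "x < 1" using z by (auto simp: x_def field_simps power2_eq_square)
  qed
  have eq: "norm (d k) * norm (- z) ^ k * (1 - norm (- z)) powr (- (norm a + real (2 * k)))
      = (1 - norm z) powr (- norm a) * (norm (hyp_coeff (a / 2) (a / 2 + 1 / 2) c k) * x ^ k)" for k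
  proof -
    have "(1 - norm z) powr (- (norm a + real (2 * k))) = (1 - norm z) powr (- norm a) / ((1 - norm z)\<^sup>2) ^ k"
    proof -
      have pos: "0 < 1 - norm z" using z by simp
      have "- (norm a + real (2 * k)) = - norm a - real (2 * k)" by simp
      then show ?thesis by (simp only: powr_diff powr_realpow[OF pos] power_mult)
    qed
    then show ?thesis unfolding d_def pochhammer_even_rGamma x_def
      by (simp add: norm_mult norm_power power_divide power_mult_distrib)
  qed
  have sm: "summable (\<lambda>k. norm (d k) * norm (- z) ^ k * (1 - norm (- z)) powr (- (norm a + real (2 * k))))"
    unfolding eq by (intro summable_mult hyp_coeff_summable x)
  have coeff: "(\<Sum>k\<le>n. (-1) ^ k * d k * pochhammer (a + of_nat (2 * k)) (n - k) / fact (n - k))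
      = (-1) ^ n * hyp_coeff a b c n" for n
  proof -
    have "(-1) ^ k * d k * pochhammer (a + of_nat (2 * k)) (n - k) / fact (n - k)
      = pochhammer a n / fact n * (of_nat (n choose k) * ((-1) ^ k * pochhammer (a + of_nat n) k * rGamma (c + of_nat k)))"
      if "k \<le> n" for k
    proof -
      \<comment> \<open>Regrouping (a)_(n+k) as (a)_n (a + n)_k makes the inner sum Chu-Vandermonde
        with B = a + n. Its value contains (1 - b - n)_n, which is (-1)^n (b)_n.\<close>
      have "pochhammer a (2 * k) * pochhammer (a + of_nat (2 * k)) (n - k) = pochhammer a (2 * k + (n - k))"
        by (rule pochhammer_product'[symmetric])
      also have "2 * k + (n - k) = n + k" using that by simp
      also have "pochhammer a (n + k) = pochhammer a n * pochhammer (a + of_nat n) k" by (rule pochhammer_product')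
      finally have "pochhammer a (2 * k) * pochhammer (a + of_nat (2 * k)) (n - k) = pochhammer a n * pochhammer (a + of_nat n) k" .
      then show ?thesis using binomial_fact[OF that, where ?'a = complex]
        by (simp add: d_def field_simps)
    qed
    then have "(\<Sum>k\<le>n. (-1) ^ k * d k * pochhammer (a + of_nat (2 * k)) (n - k) / fact (n - k))
      = pochhammer a n / fact n * (\<Sum>k\<le>n. of_nat (n choose k) * ((-1) ^ k * pochhammer (a + of_nat n) k * rGamma (c + of_nat k)))"
      unfolding sum_distrib_left by (intro sum.cong) auto
    also have "\<dots> = pochhammer a n / fact n * (pochhammer (c - (a + of_nat n)) n * rGamma (c + of_nat n))"
      by (simp only: chu_vandermonde_rGamma)
    also have "c - (a + of_nat n) = - b - of_nat n + 1" by (simp add: c_def)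
    finally show ?thesis using pochhammer_minus'[of "- b" n] by (simp add: hyp_coeff_def)
  qed
  have "hyp_coeff a b c n * z ^ n = (- z) ^ n * ((-1) ^ n * hyp_coeff a b c n)" for n
    by (simp add: power_minus[of z])
  then have "hyp2F1_reg a b c z = (\<Sum>n. (- z) ^ n * ((-1) ^ n * hyp_coeff a b c n))"
    unfolding hyp2F1_reg_eq by (simp only:)
  also have "\<dots> = (\<Sum>k. d k * (- (- z)) ^ k * (1 - (- z)) powr (- (a + of_nat (2 * k))))"
    using binomial_transform_sums[OF z1(1) sm] unfolding coeff by (simp only: sums_iff)
  finally show ?thesis unfolding d_def c_def by simp
qed

text \<open>Lowers the degree: in the variable \<open>sinh s\<close> this becomes \<open>G' = - (\<mu> - \<rho>) G\<close> at degree \<open>\<rho> - 1\<close>.\<close>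

lemma hyp2F1_reg_ladder:
  assumes z: "norm z < 1"
  shows "(\<rho> * (1 - 2 * z) - \<mu>) * hyp2F1_reg (- \<rho>) (\<rho> + 1) (1 + \<mu>) z
      - 2 * z * (1 - z) * (\<Sum>k. diffs (hyp_coeff (- \<rho>) (\<rho> + 1) (1 + \<mu>)) k * z ^ k)
     = (\<rho> - \<mu>) * hyp2F1_reg (1 - \<rho>) \<rho> (1 + \<mu>) z"
proof -
  define p where "p = hyp_coeff (- \<rho>) (\<rho> + 1) (1 + \<mu>)"
  define q where "q = hyp_coeff (1 - \<rho>) \<rho> (1 + \<mu>)"
  \<comment> \<open>Comparison of the coefficients of z^(k+1). All three terms share the factor X R,
    and a polynomial identity in k remains.\<close>
  have rec: "(\<rho> - \<mu> - 2 * of_nat (Suc k)) * p (Suc k) - (\<rho> - \<mu>) * q (Suc k) = 2 * (\<rho> - of_nat k) * p k" for k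
  proof -
    define X where "X = pochhammer (- \<rho>) k * pochhammer (\<rho> + 1) k / fact (Suc k)"
    define R where "R = rGamma (1 + \<mu> + of_nat (Suc k))"
    have f: "(fact (Suc k) :: complex) = (of_nat k + 1) * fact k" by simp
    have n0: "of_nat k + 1 \<noteq> (0 :: complex)" by (metis of_nat_Suc of_nat_neq_0 add.commute)
    have X: "X * (of_nat k + 1) = pochhammer (- \<rho>) k * pochhammer (\<rho> + 1) k / fact k"
      unfolding X_def f using n0 by simp
    have R: "rGamma (1 + \<mu> + of_nat k) = (1 + \<mu> + of_nat k) * R"
      using rGamma_plus1[of "1 + \<mu> + of_nat k"] by (simp add: R_def add_ac)
    have a: "p (Suc k) = X * (of_nat k - \<rho>) * (\<rho> + 1 + of_nat k) * R"
      unfolding p_def hyp_coeff_def X_def R_def pochhammer_rec' by (simp add: mult_ac del: fact_Suc)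
    have b: "p k = X * (of_nat k + 1) * (1 + \<mu> + of_nat k) * R"
      unfolding p_def hyp_coeff_def R X by simp
    have "\<rho> * pochhammer (1 - \<rho>) k = pochhammer (- \<rho>) k * (\<rho> - of_nat k)"
      using pochhammer_rec[of "- \<rho>" k] pochhammer_rec'[of "- \<rho>" k] by (simp add: algebra_simps)
    moreover have "pochhammer (1 - \<rho>) (Suc k) * pochhammer \<rho> (Suc k)
        = (\<rho> * pochhammer (1 - \<rho>) k) * ((of_nat k + 1 - \<rho>) * pochhammer (\<rho> + 1) k)"
      unfolding pochhammer_rec[of \<rho>] pochhammer_rec'[of "1 - \<rho>"] by (simp add: algebra_simps)
    ultimately have c: "q (Suc k) = X * (\<rho> - of_nat k) * (of_nat k + 1 - \<rho>) * R"
      unfolding q_def hyp_coeff_def X_def R_def by (simp del: fact_Suc pochhammer_Suc)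
    show ?thesis unfolding a b c by (simp add: algebra_simps)
  qed
  have p: "summable (\<lambda>k. p k * z ^ k)" and q: "summable (\<lambda>k. q k * z ^ k)"
    unfolding p_def q_def using z by (auto intro!: hyp2F1_reg_summable)
  have d: "summable (\<lambda>k. diffs p k * z ^ k)"
    using termdiff_converges[of z 1 p] z unfolding p_def by (simp add: hyp2F1_reg_summable)
  define P where "P = (\<Sum>k. p k * z ^ k)"
  define Q where "Q = (\<Sum>k. q k * z ^ k)"
  define D where "D = (\<Sum>k. diffs p k * z ^ k)"
  have zD: "(\<lambda>k. of_nat k * p k * z ^ k) sums (z * D)"
  proof -
    have "(\<lambda>k. z * (diffs p k * z ^ k)) sums (z * D)"
      unfolding D_def by (intro sums_mult summable_sums d)
    then have "(\<lambda>k. of_nat (Suc k) * p (Suc k) * z ^ Suc k) sums (z * D)"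
      by (simp add: diffs_def mult_ac)
    then show ?thesis by (subst (asm) sums_Suc_iff) simp
  qed
  have S1: "(\<lambda>k. ((\<rho> - \<mu> - 2 * of_nat k) * p k - (\<rho> - \<mu>) * q k) * z ^ k)
      sums ((\<rho> - \<mu>) * P - 2 * (z * D) - (\<rho> - \<mu>) * Q)"
  proof -
    have "(\<lambda>k. (\<rho> - \<mu>) * (p k * z ^ k) - 2 * (of_nat k * p k * z ^ k) - (\<rho> - \<mu>) * (q k * z ^ k))
      sums ((\<rho> - \<mu>) * P - 2 * (z * D) - (\<rho> - \<mu>) * Q)"
      unfolding P_def Q_def by (intro sums_diff sums_mult zD summable_sums p q)
    then show ?thesis by (simp add: algebra_simps)
  qed
  have "(\<lambda>k. z * (2 * \<rho> * (p k * z ^ k) - 2 * (of_nat k * p k * z ^ k))) sums (z * (2 * \<rho> * P - 2 * (z * D)))"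
    unfolding P_def by (intro sums_diff sums_mult zD summable_sums p)
  also have "(\<lambda>k. z * (2 * \<rho> * (p k * z ^ k) - 2 * (of_nat k * p k * z ^ k)))
     = (\<lambda>k. ((\<rho> - \<mu> - 2 * of_nat (Suc k)) * p (Suc k) - (\<rho> - \<mu>) * q (Suc k)) * z ^ Suc k)"
    unfolding rec by (simp add: fun_eq_iff algebra_simps)
  \<comment> \<open>The index shift loses nothing: the constant term vanishes because
    \<open>p 0\<close> and \<open>q 0\<close> are both \<open>rGamma (1 + \<mu>)\<close>.\<close>
  finally have "(\<lambda>k. ((\<rho> - \<mu> - 2 * of_nat k) * p k - (\<rho> - \<mu>) * q k) * z ^ k) sums (z * (2 * \<rho> * P - 2 * (z * D)))"
    by (subst (asm) sums_Suc_iff) (simp add: p_def q_def hyp_coeff_def)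
  with S1 have "(\<rho> - \<mu>) * P - 2 * (z * D) - (\<rho> - \<mu>) * Q = z * (2 * \<rho> * P - 2 * (z * D))"
    by (rule sums_unique2)
  then show ?thesis
    unfolding hyp2F1_reg_eq p_def[symmetric] q_def[symmetric] P_def[symmetric] Q_def[symmetric] D_def[symmetric]
    by (simp add: algebra_simps)
qed

subsection \<open>Ferrers functions in hyperbolic variables\<close>

text \<open>This is cosh^\<rho> s P_\<rho>^(-\<mu>)(tanh s) (see \<open>ferrers_cosh_eq\<close>).
  Explicit exponentials make it easy to differentiate and to estimate.\<close>

definition ferrers_cosh :: "complex \<Rightarrow> complex \<Rightarrow> real \<Rightarrow> complex" where
  "ferrers_cosh \<mu> \<rho> s = exp (\<rho> * of_real (ln (cosh s)) - \<mu> * of_real s) *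
     hyp2F1_reg (- \<rho>) (\<rho> + 1) (1 + \<mu>) (of_real (1 / (1 + exp (2 * s))))"

lemma tanh_real_alt: "tanh s = 1 - 2 / (1 + exp (2 * s))" for s :: real
  unfolding tanh_altdef exp_double power2_eq_square
  by (simp add: exp_minus field_simps add_nonneg_eq_0_iff)

lemma of_real_powr: "x > 0 \<Longrightarrow> complex_of_real x powr w = exp (w * of_real (ln x))"
  by (simp add: powr_def Ln_of_real)

text \<open>At x = tanh s the quotient (1 - x) / (1 + x) is e^(-2s) and (1 - x) / 2 is 1 / (1 +
  e^(2s)). The exponent \<open>w\<close> is left free because part (ii) needs other powers of cosh
  than the degree.\<close>

lemma cosh_powr_ferrers_P:
  "of_real (cosh s) powr w * ferrers_P \<rho> (- \<mu>) (tanh s) = exp (w * of_real (ln (cosh s)) - \<mu> * of_real s) *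
     hyp2F1_reg (- \<rho>) (\<rho> + 1) (1 + \<mu>) (of_real (1 / (1 + exp (2 * s))))"
proof -
  have e: "1 + exp (2 * s) > 0" by (simp add: add_pos_pos)
  have 1: "(1 - tanh s) / 2 = 1 / (1 + exp (2 * s))" using e by (simp add: tanh_real_alt field_simps)
  have 3: "1 - tanh s = 2 / (1 + exp (2 * s))" by (simp add: tanh_real_alt)
  have 4: "1 + tanh s = 2 * exp (2 * s) / (1 + exp (2 * s))"
    using e by (simp add: tanh_real_alt field_simps)
  have 2: "(1 - tanh s) / (1 + tanh s) = exp (- 2 * s)"
  proof -
    have eq: "2 / D / (2 * x / D) = 1 / x" if "D > 0" "x > 0" for D x :: real
      using that by simp
    show ?thesis unfolding 3 4 eq[OF e exp_gt_zero] by (simp add: exp_minus inverse_eq_divide)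
  qed
  have "of_real ((1 - tanh s) / (1 + tanh s)) powr (\<mu> / 2) = exp (- \<mu> * of_real s)"
    unfolding 2 by (subst of_real_powr) auto
  then show ?thesis
    unfolding ferrers_P_uminus 1 by (simp add: of_real_powr exp_diff exp_minus field_simps)
qed

lemma ferrers_cosh_eq:
  "of_real (cosh s) powr \<rho> * ferrers_P \<rho> (- \<mu>) (tanh s) = ferrers_cosh \<mu> \<rho> s"
  unfolding ferrers_cosh_def by (rule cosh_powr_ferrers_P)

lemma norm_ferrers_arg: "norm (complex_of_real (1 / (1 + exp (2 * s)))) < 1"
proof -
  have le: "\<bar>1 / (1 + x)\<bar> < 1" if "x > 0" for x :: real
    using that by simp
  show ?thesis unfolding norm_of_real by (rule le) simp
qed

text \<open>For z = 1 / (1 + e^(2s)) one has tanh s = 1 - 2z and z' = -2z (1 - z), exactly the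
  coefficients in \<open>hyp2F1_reg_ladder\<close>.\<close>

lemma has_vector_derivative_ferrers_cosh:
  "(ferrers_cosh \<mu> \<rho> has_vector_derivative of_real (cosh s) * ((\<rho> - \<mu>) * ferrers_cosh \<mu> (\<rho> - 1) s)) (at s)"
proof -
  define z where "z = (\<lambda>s. complex_of_real (1 / (1 + exp (2 * s))))"
  define E where "E = (\<lambda>s. exp (\<rho> * of_real (ln (cosh s)) - \<mu> * complex_of_real s))"
  define F where "F = hyp2F1_reg (- \<rho>) (\<rho> + 1) (1 + \<mu>)"
  define F' where "F' = (\<lambda>z. \<Sum>k. diffs (hyp_coeff (- \<rho>) (\<rho> + 1) (1 + \<mu>)) k * z ^ k)"
  have e: "1 + exp (2 * s) > 0" for s :: real by (simp add: add_pos_pos)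
  have nz: "norm (z s) < 1" unfolding z_def by (rule norm_ferrers_arg)
  have th: "complex_of_real (tanh s) = 1 - 2 * z s" by (simp add: tanh_real_alt z_def)
  have ch: "exp (- of_real (ln (cosh s))) * complex_of_real (cosh s) = 1"
    by (simp add: exp_minus exp_of_real)
  have "((\<lambda>s. 1 / (1 + exp (2 * s))) has_real_derivative (- 2 * (1 / (1 + exp (2 * s))) * (1 - 1 / (1 + exp (2 * s))))) (at s)"
    using e[of s] by (auto intro!: derivative_eq_intros simp: field_simps power2_eq_square)
  from has_vector_derivative_of_real[OF this, where ?'a = complex]
  have dz: "(z has_vector_derivative (- 2 * z s * (1 - z s))) (at s)"
    unfolding z_def by simp
  have dF: "((F \<circ> z) has_vector_derivative (- 2 * z s * (1 - z s)) * F' (z s)) (at s)"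
    unfolding F_def F'_def
    by (rule field_vector_diff_chain_at[OF dz has_field_derivative_hyp2F1_reg[OF nz]])
  have "((\<lambda>s. ln (cosh s)) has_real_derivative tanh s) (at s)"
    by (auto intro!: derivative_eq_intros simp: tanh_def)
  from has_vector_derivative_of_real[OF this, where ?'a = complex]
  have "((\<lambda>s. \<rho> * of_real (ln (cosh s)) - \<mu> * complex_of_real s) has_vector_derivative (\<rho> * of_real (tanh s) - \<mu>)) (at s)"
    by (auto intro!: derivative_eq_intros simp: tanh_def)
  then have dE: "((exp \<circ> (\<lambda>s. \<rho> * of_real (ln (cosh s)) - \<mu> * complex_of_real s)) has_vector_derivative
      (\<rho> * of_real (tanh s) - \<mu>) * E s) (at s)"
    unfolding E_def by (rule field_vector_diff_chain_at) (rule DERIV_exp)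
  have "((\<lambda>s. E s * F (z s)) has_vector_derivative
      E s * (- 2 * z s * (1 - z s) * F' (z s)) + (\<rho> * of_real (tanh s) - \<mu>) * E s * F (z s)) (at s)"
    using has_vector_derivative_mult[OF dE dF] by (simp add: o_def E_def)
  also have "E s * (- 2 * z s * (1 - z s) * F' (z s)) + (\<rho> * of_real (tanh s) - \<mu>) * E s * F (z s)
      = E s * ((\<rho> * (1 - 2 * z s) - \<mu>) * F (z s) - 2 * z s * (1 - z s) * F' (z s))"
    unfolding th by (simp add: algebra_simps)
  also have "\<dots> = E s * ((\<rho> - \<mu>) * hyp2F1_reg (1 - \<rho>) \<rho> (1 + \<mu>) (z s))"
    unfolding F_def F'_def using hyp2F1_reg_ladder[OF nz] by simp
  also have "E s = of_real (cosh s) * exp ((\<rho> - 1) * of_real (ln (cosh s)) - \<mu> * of_real s)"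
  proof -
    have "exp ((\<rho> - 1) * of_real (ln (cosh s)) - \<mu> * of_real s) = E s * exp (- of_real (ln (cosh s)))"
      unfolding E_def exp_add[symmetric] by (simp add: algebra_simps)
    then show ?thesis using ch by (simp add: mult_ac)
  qed
  also have "\<dots> * ((\<rho> - \<mu>) * hyp2F1_reg (1 - \<rho>) \<rho> (1 + \<mu>) (z s)) = of_real (cosh s) * ((\<rho> - \<mu>) * ferrers_cosh \<mu> (\<rho> - 1) s)"
    by (simp add: ferrers_cosh_def z_def)
  finally show ?thesis unfolding E_def F_def z_def ferrers_cosh_def .
qed

section \<open>The function G of the overview: derivative, uniform bound and Taylor series\<close>

definition ferrers_sinh :: "complex \<Rightarrow> complex \<Rightarrow> real \<Rightarrow> complex" where
  "ferrers_sinh \<mu> \<rho> y = ferrers_cosh \<mu> \<rho> (arsinh y)"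

lemma cosh_arsinh: "cosh (arsinh y) = sqrt (y\<^sup>2 + 1)" for y :: real
proof -
  have "(cosh (arsinh y))\<^sup>2 = y\<^sup>2 + 1" by (simp add: cosh_square_eq)
  then show ?thesis by (metis cosh_real_nonneg real_sqrt_unique)
qed

lemma exp_arsinh: "exp (arsinh y) = y + sqrt (y\<^sup>2 + 1)" for y :: real
  using sinh_plus_cosh[of "arsinh y"] by (simp add: cosh_arsinh)

lemma has_vector_derivative_ferrers_sinh:
  "(ferrers_sinh \<mu> \<rho> has_vector_derivative (\<rho> - \<mu>) * ferrers_sinh \<mu> (\<rho> - 1) y) (at y)"
proof -
  have d: "(arsinh has_vector_derivative (1 / cosh (arsinh y))) (at y)"
    using arsinh_real_has_field_derivative[of y UNIV]
    by (simp add: cosh_arsinh has_real_derivative_iff_has_vector_derivative)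
  have "((ferrers_cosh \<mu> \<rho> \<circ> arsinh) has_vector_derivative
      (1 / cosh (arsinh y)) *\<^sub>R (of_real (cosh (arsinh y)) * ((\<rho> - \<mu>) * ferrers_cosh \<mu> (\<rho> - 1) (arsinh y)))) (at y)"
    by (rule vector_diff_chain_at[OF d has_vector_derivative_ferrers_cosh])
  then show ?thesis
    by (simp add: ferrers_sinh_def[abs_def] o_def scaleR_conv_of_real)
qed

lemma continuous_on_ferrers_sinh: "continuous_on S (ferrers_sinh \<mu> \<rho>)"
  using has_vector_derivative_ferrers_sinh
  by (intro continuous_at_imp_continuous_on ballI) (rule has_vector_derivative_continuous)

text \<open>Since cosh s is e^s up to a factor bounded for s \<ge> \<open>s0\<close>, the
  exponential prefactor decays like e^(-Re (\<mu> - \<rho>) s). Lowering the degree adds cosh^(-k) s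
  \<le> 1, and the hypergeometric factor costs R^k because its argument stays at most 1 / (1 + e^(2
  s0)) < 1.\<close>

lemma ferrers_sinh_bound:
  assumes b: "Re (\<mu> - \<rho>) > 0"
  obtains C R where "C > 0" "R \<ge> 1"
    "\<And>k v. v \<ge> 0 \<Longrightarrow> norm (ferrers_sinh \<mu> (\<rho> - of_nat k) (x + v)) \<le> C * R ^ k * (1 + v) powr (- Re (\<mu> - \<rho>))"
proof -
  define b where "b = Re (\<mu> - \<rho>)"
  define s0 where "s0 = arsinh x"
  \<comment> \<open>Bounds the difference between \<open>ln (cosh s)\<close> and \<open>s\<close>
    for s \<ge> \<open>s0\<close>.\<close>
  define M where "M = ln 2 + exp (- 2 * s0)"
  \<comment> \<open>Chosen to give 1 + v \<le> K e^s: from e^s = y + sqrt (y^2 + 1) at y = x + v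
    follows v \<le> e^s + |x|, and the constant |x| + 1 is absorbed by e^s \<ge> e^s0.\<close>
  define K where "K = 1 + (\<bar>x\<bar> + 1) / exp s0"
  define r where "r = norm \<rho> + 1"
  have K: "K \<ge> 1" by (simp add: K_def)
  have e: "1 + exp (2 * s) > 0" for s :: real by (simp add: add_pos_pos)
  obtain C R where C: "C > 0" "R \<ge> 1"
    "\<And>r a b z. norm a \<le> r \<Longrightarrow> norm b \<le> r \<Longrightarrow> norm z \<le> 1 / (1 + exp (2 * s0)) \<Longrightarrow>
       norm (hyp2F1_reg a b (1 + \<mu>) z) \<le> C * R powr r"
    by (rule hyp2F1_reg_bound[of "1 / (1 + exp (2 * s0))" "1 + \<mu>"]) (use e[of s0] in auto)
  define C' where "C' = exp (\<bar>Re \<rho>\<bar> * M) * K powr b * (C * R powr r)"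
  have "norm (ferrers_sinh \<mu> (\<rho> - of_nat k) (x + v)) \<le> C' * R ^ k * (1 + v) powr (- b)" if v: "v \<ge> 0" for k v
  proof -
    define s where "s = arsinh (x + v)"
    have s: "s0 \<le> s"
      unfolding s_def s0_def using v by (cases "v = 0") (auto intro!: less_imp_le)
    have cosh_s: "ln (cosh s) = s + ln ((1 + exp (- 2 * s)) / 2)"
    proof -
      have "cosh s = exp s * ((1 + exp (- 2 * s)) / 2)"
        by (simp add: cosh_field_def algebra_simps flip: exp_add)
      then show ?thesis by (simp only:) (subst ln_mult, auto simp: add_pos_pos)
    qed
    have "\<bar>ln ((1 + exp (- 2 * s)) / 2)\<bar> \<le> M"
    proof -
      have "ln (1 + exp (- 2 * s)) \<le> exp (- 2 * s)" by (rule ln_add_one_self_le_self) simp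
      also have "\<dots> \<le> exp (- 2 * s0)" using s by simp
      finally have "ln (1 + exp (- 2 * s)) \<le> exp (- 2 * s0)" .
      moreover have "ln (1 + exp (- 2 * s)) \<ge> 0" by simp
      moreover have "ln 2 \<ge> (0 :: real)" by simp
      moreover have "ln ((1 + exp (- 2 * s)) / 2) = ln (1 + exp (- 2 * s)) - ln 2"
        using add_pos_pos[OF zero_less_one exp_gt_zero[of "- 2 * s"]] by (simp add: ln_div)
      moreover have "exp (- 2 * s0) \<ge> 0" by simp
      ultimately show ?thesis unfolding M_def by linarith
    qed
    then have "Re \<rho> * ln ((1 + exp (- 2 * s)) / 2) \<le> \<bar>Re \<rho>\<bar> * M"
      by (rule order_trans[OF abs_ge_self, OF ord_eq_le_trans[OF abs_mult mult_left_mono]]) simp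
    moreover have "real k * ln (cosh s) \<ge> 0" using cosh_real_ge_1[of s] by simp
    ultimately have "Re (\<rho> - of_nat k) * ln (cosh s) - Re \<mu> * s \<le> \<bar>Re \<rho>\<bar> * M - b * s"
      unfolding b_def by (simp add: algebra_simps) (simp add: cosh_s algebra_simps)
    then have 1: "norm (exp ((\<rho> - of_nat k) * of_real (ln (cosh s)) - \<mu> * of_real s)) \<le> exp (\<bar>Re \<rho>\<bar> * M) * exp (- b * s)"
      by (simp add: norm_exp_eq_Re flip: exp_add)
    have "1 + v \<le> K * exp s"
    proof -
      have "exp s0 \<le> exp s" using s by simp
      then have "(\<bar>x\<bar> + 1) / exp s0 * exp s0 \<le> (\<bar>x\<bar> + 1) / exp s0 * exp s"
        by (intro mult_left_mono) auto
      moreover have "(\<bar>x\<bar> + 1) / exp s0 * exp s0 = \<bar>x\<bar> + 1" by simp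
      moreover have "0 \<le> sqrt ((x + v)\<^sup>2 + 1)" by simp
      then have "v \<le> exp s + \<bar>x\<bar>" unfolding s_def exp_arsinh by linarith
      moreover have "K * exp s = exp s + (\<bar>x\<bar> + 1) / exp s0 * exp s"
        unfolding K_def by (simp only: distrib_right mult_1)
      ultimately show ?thesis by linarith
    qed
    then have "(K * exp s) powr (- b) \<le> (1 + v) powr (- b)"
      using b v by (intro powr_mono2') (auto simp: b_def)
    moreover have "(K * exp s) powr (- b) = K powr (- b) * exp (- b * s)"
      using K by (simp add: powr_mult) (simp add: powr_def)
    ultimately have "K powr b * (K powr (- b) * exp (- b * s)) \<le> K powr b * (1 + v) powr (- b)"
      by (intro mult_left_mono) auto
    moreover have "K powr b * K powr (- b) = 1" using K by (simp add: powr_minus)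
    ultimately have 2: "exp (- b * s) \<le> K powr b * (1 + v) powr (- b)"
      by (simp only: mult.assoc[symmetric] mult_1)
    have "norm (- (\<rho> - of_nat k)) \<le> r + real k" "norm (\<rho> - of_nat k + 1) \<le> r + real k"
      using norm_triangle_ineq4[of \<rho> "of_nat k"] norm_triangle_ineq[of "\<rho> - of_nat k" 1]
      unfolding norm_minus_cancel r_def norm_of_nat norm_one by linarith+
    moreover have "norm (complex_of_real (1 / (1 + exp (2 * s)))) \<le> 1 / (1 + exp (2 * s0))"
    proof -
      have le: "\<bar>1 / (1 + d)\<bar> \<le> 1 / (1 + c)" if "0 < c" "c \<le> d" for c d :: real
        using that by (simp add: frac_le)
      show ?thesis unfolding norm_of_real by (rule le) (use s in auto)
    qed
    ultimately have "norm (hyp2F1_reg (- (\<rho> - of_nat k)) (\<rho> - of_nat k + 1) (1 + \<mu>) (of_real (1 / (1 + exp (2 * s)))))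
        \<le> C * R powr (r + real k)"
      by (rule C(3))
    also have "\<dots> = (C * R powr r) * R ^ k" using C(2) by (simp add: powr_add powr_realpow)
    finally have 3: "norm (hyp2F1_reg (- (\<rho> - of_nat k)) (\<rho> - of_nat k + 1) (1 + \<mu>) (of_real (1 / (1 + exp (2 * s)))))
        \<le> (C * R powr r) * R ^ k" .
    have "norm (ferrers_sinh \<mu> (\<rho> - of_nat k) (x + v)) \<le> (exp (\<bar>Re \<rho>\<bar> * M) * exp (- b * s)) * ((C * R powr r) * R ^ k)"
      unfolding ferrers_sinh_def ferrers_cosh_def s_def[symmetric] norm_mult
      by (intro mult_mono 1 3) auto
    also have "\<dots> \<le> (exp (\<bar>Re \<rho>\<bar> * M) * (K powr b * (1 + v) powr (- b))) * ((C * R powr r) * R ^ k)"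
      using 2 C by (intro mult_right_mono mult_left_mono) auto
    finally show ?thesis by (simp add: C'_def mult_ac)
  qed
  moreover have "C' > 0" using C K by (simp add: C'_def)
  ultimately show ?thesis using C(2) by (intro that[of C' R]) (auto simp: b_def)
qed

text \<open>The n-th derivative of G(y - \<tau>) in \<tau> is (\<mu> - \<rho>)_n times the function
  of degree \<rho> - n, by iterating the derivative rule. With the geometric bound, the remainder is
  at most a constant times the n-th term of a binomial series in h R < 1, so it tends to 0.\<close>

lemma ferrers_sinh_taylor:
  assumes h: "h \<ge> 0" "h * R < 1" "R \<ge> 0"
    and bd: "\<And>k t. y - h \<le> t \<Longrightarrow> t \<le> y \<Longrightarrow> norm (ferrers_sinh \<mu> (\<rho> - of_nat k) t) \<le> B * R ^ k"
  shows "(\<lambda>k. pochhammer (\<mu> - \<rho>) k / fact k * of_real h ^ k * ferrers_sinh \<mu> (\<rho> - of_nat k) y)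
     sums ferrers_sinh \<mu> \<rho> (y - h)"
proof -
  define A where "A = norm (\<mu> - \<rho>)"
  define Df where "Df k \<tau> = pochhammer (\<mu> - \<rho>) k * ferrers_sinh \<mu> (\<rho> - of_nat k) (y - \<tau>)" for k \<tau>
  have B: "B \<ge> 0" using order_trans[OF norm_ge_zero bd[of y 0]] h by simp
  have dD: "(Df m has_vector_derivative Df (Suc m) t) (at t within {0..h})" for m t
  proof -
    have "((\<lambda>\<tau>. y - \<tau>) has_vector_derivative - 1) (at t)"
      by (auto intro!: derivative_eq_intros)
    from vector_diff_chain_at[OF this has_vector_derivative_ferrers_sinh[of \<mu> "\<rho> - of_nat m"]]
    have "((\<lambda>\<tau>. ferrers_sinh \<mu> (\<rho> - of_nat m) (y - \<tau>)) has_vector_derivative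
        (\<mu> - \<rho> + of_nat m) * ferrers_sinh \<mu> (\<rho> - of_nat (Suc m)) (y - t)) (at t)"
      by (simp add: o_def algebra_simps)
    from bounded_linear.has_vector_derivative[OF bounded_linear_mult_right this, of "pochhammer (\<mu> - \<rho>) m"]
    have "(Df m has_vector_derivative Df (Suc m) t) (at t)"
      unfolding Df_def pochhammer_rec' by (simp only: mult_ac)
    then show ?thesis by (rule has_vector_derivative_at_within)
  qed
  have rem: "norm (ferrers_sinh \<mu> \<rho> (y - h) - (\<Sum>i<Suc n. pochhammer (\<mu> - \<rho>) i / fact i * of_real h ^ i * ferrers_sinh \<mu> (\<rho> - of_nat i) y))
      \<le> B * A * (h * R) * (pochhammer (A + 1) n / fact n * (h * R) ^ n)" for n
  proof -
    let ?i = "\<lambda>t. ((h - t) ^ (Suc n - 1) / fact (Suc n - 1)) *\<^sub>R Df (Suc n) t"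
    have int: "(?i has_integral Df 0 h - (\<Sum>i<Suc n. ((h - 0) ^ i / fact i) *\<^sub>R Df i 0)) {0..h}"
      by (rule Taylor_has_integral[where Df = Df and f = "Df 0"]) (use dD h(1) in auto)
    \<comment> \<open>The crude estimate, supremum of the integrand times the length h, suffices;
      (A)_(n+1) = A (A + 1)_n then brings out the binomial coefficient.\<close>
    have "norm (Df 0 h - (\<Sum>i<Suc n. ((h - 0) ^ i / fact i) *\<^sub>R Df i 0))
      \<le> (h ^ n / fact n * (pochhammer A (Suc n) * (B * R ^ Suc n))) * Henstock_Kurzweil_Integration.content {0..h}"
    proof (rule has_integral_bound_real[OF _ finite.emptyI int])
      fix t assume "t \<in> {0..h} - {}"
      then have t: "t \<in> {0..h}" by simp
      have "norm (Df (Suc n) t) \<le> pochhammer A (Suc n) * (B * R ^ Suc n)"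
        unfolding Df_def norm_mult using t
        by (intro mult_mono norm_pochhammer_le bd pochhammer_ge_0) (auto simp: A_def)
      moreover have "(h - t) ^ n \<le> h ^ n" using t by (intro power_mono) auto
      ultimately have "(h - t) ^ n / fact n * norm (Df (Suc n) t) \<le> h ^ n / fact n * (pochhammer A (Suc n) * (B * R ^ Suc n))"
        using t h(1) by (intro mult_mono divide_right_mono) auto
      then show "norm (?i t) \<le> h ^ n / fact n * (pochhammer A (Suc n) * (B * R ^ Suc n))"
        using t by simp
    next
      show "0 \<le> h ^ n / fact n * (pochhammer A (Suc n) * (B * R ^ Suc n))"
        unfolding A_def by (intro mult_nonneg_nonneg divide_nonneg_nonneg pochhammer_ge_0 zero_le_power norm_ge_zero B h) simp
    qed
    also have "(h ^ n / fact n * (pochhammer A (Suc n) * (B * R ^ Suc n))) * Henstock_Kurzweil_Integration.content {0..h}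
       = B * A * (h * R) * (pochhammer (A + 1) n / fact n * (h * R) ^ n)"
      using h(1) by (simp add: pochhammer_rec power_mult_distrib del: pochhammer_Suc)
    also have "Df 0 h - (\<Sum>i<Suc n. ((h - 0) ^ i / fact i) *\<^sub>R Df i 0)
      = ferrers_sinh \<mu> \<rho> (y - h) - (\<Sum>i<Suc n. pochhammer (\<mu> - \<rho>) i / fact i * of_real h ^ i * ferrers_sinh \<mu> (\<rho> - of_nat i) y)"
      by (simp add: Df_def scaleR_conv_of_real mult_ac del: sum.lessThan_Suc)
    finally show ?thesis .
  qed
  have "summable (\<lambda>n. pochhammer (A + 1) n / fact n * (h * R) ^ n)"
    using pochhammer_binomial_sums_real[of "h * R" "A + 1"] h by (auto simp: sums_iff)
  then have "(\<lambda>n. B * A * (h * R) * (pochhammer (A + 1) n / fact n * (h * R) ^ n)) \<longlonglongrightarrow> 0"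
    by (intro tendsto_mult_right_zero summable_LIMSEQ_zero)
  then have "(\<lambda>n. ferrers_sinh \<mu> \<rho> (y - h) - (\<Sum>i<Suc n. pochhammer (\<mu> - \<rho>) i / fact i * of_real h ^ i * ferrers_sinh \<mu> (\<rho> - of_nat i) y)) \<longlonglongrightarrow> 0"
    by (rule Lim_null_comparison[OF always_eventually, rotated]) (use rem in blast)
  then have "(\<lambda>n. (\<Sum>i<Suc n. pochhammer (\<mu> - \<rho>) i / fact i * of_real h ^ i * ferrers_sinh \<mu> (\<rho> - of_nat i) y)) \<longlonglongrightarrow> ferrers_sinh \<mu> \<rho> (y - h)"
    using tendsto_diff[OF tendsto_const[of "ferrers_sinh \<mu> \<rho> (y - h)"]] by (force simp del: sum.lessThan_Suc)
  then show ?thesis unfolding sums_def by (rule LIMSEQ_imp_Suc)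
qed

subsection \<open>The Weyl fractional integral\<close>

text \<open>Coefficients of G in descending powers of y. The powers of -1/4 come from z = -e^(-2s)
  and 1 + z = 2 e^(-s) y in the quadratic transformation.\<close>

definition infinity_coeff :: "complex \<Rightarrow> complex \<Rightarrow> nat \<Rightarrow> complex" where
  "infinity_coeff \<mu> \<rho> k = 2 powr (- \<mu>) * (- 1 / 4) ^ k *
     (pochhammer (\<mu> - \<rho>) (2 * k) * rGamma (1 + \<mu> + of_nat k) / fact k)"

lemma infinity_coeff_summable:
  assumes "y \<ge> 2"
  shows "summable (\<lambda>k. norm (infinity_coeff \<mu> \<rho> k) * (1 / y\<^sup>2) ^ k)"
proof -
  let ?h = "hyp_coeff ((\<mu> - \<rho>) / 2) ((\<mu> - \<rho>) / 2 + 1 / 2) (1 + \<mu>)"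
  have eq: "norm (infinity_coeff \<mu> \<rho> k) * (1 / y\<^sup>2) ^ k = norm (2 powr (- \<mu>)) * (norm (?h k) * (1 / y\<^sup>2) ^ k)" for k
    unfolding infinity_coeff_def pochhammer_even_rGamma by (simp add: norm_mult norm_power norm_divide power_divide)
  have "2\<^sup>2 \<le> y\<^sup>2" using assms by (intro power_mono) auto
  then have "1 / y\<^sup>2 < 1" by (simp add: divide_less_eq)
  then show ?thesis unfolding eq by (intro summable_mult hyp_coeff_summable) auto
qed

lemma of_real_powr_minus_even:
  assumes "y > 0"
  shows "complex_of_real y powr (- (a + of_nat (2 * k))) = of_real y powr (- a) * of_real ((1 / y\<^sup>2) ^ k)"
proof -
  have "- (a + of_nat (2 * k)) = - a - of_nat (2 * k)" by simp
  moreover have "complex_of_real y powr of_nat (2 * k) = of_real y ^ (2 * k)"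
    by (rule powr_nat') (use assms in auto)
  ultimately show ?thesis by (simp only: powr_diff) (simp add: power_mult power_divide)
qed

text \<open>Put z = -e^(-2s) with sinh s = y. Then -z / (1 - z) = 1 / (1 + e^(2s)), so Pfaff turns
  the Ferrers series into F(\<mu> - \<rho>, -\<rho>; 1 + \<mu>; z), which has the shape of the
  quadratic transformation. From y \<ge> 2 follow e^s \<ge> 4 and |z| \<le> 1/16, inside both
  domains.\<close>

lemma ferrers_sinh_expansion:
  assumes y: "y \<ge> 2"
  shows "(\<lambda>k. infinity_coeff \<mu> \<rho> k * of_real y powr (- (\<mu> - \<rho> + of_nat (2 * k)))) sums ferrers_sinh \<mu> \<rho> y"
proof -
  define s where "s = arsinh y"
  define L where "L = ln (cosh s)"
  define z where "z = - complex_of_real (exp (- 2 * s))"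
  define a where "a = \<mu> - \<rho>"
  define t where "t k = pochhammer a (2 * k) * rGamma (1 + \<mu> + of_nat k) / fact k * z ^ k * (1 + z) powr (- (a + of_nat (2 * k)))" for k
  define c where "c = exp (\<rho> * of_real L - \<mu> * of_real s) / (1 - z) powr \<rho>"
  have sinh_s: "sinh s = y" by (simp add: s_def)
  have "4 \<le> exp s"
  proof -
    have "2\<^sup>2 \<le> y\<^sup>2" using y by (intro power_mono) auto
    then have "2 \<le> sqrt (y\<^sup>2 + 1)" by (intro real_le_rsqrt) simp
    then show ?thesis using y by (simp add: s_def exp_arsinh)
  qed
  then have "4 * 4 \<le> exp s * exp s" by (intro mult_mono) auto
  then have "inverse (exp s * exp s) \<le> inverse (4 * 4)" by (rule le_imp_inverse_le) simp
  moreover have "exp (- 2 * s) = inverse (exp s * exp s)"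
    by (simp add: exp_minus exp_double power2_eq_square)
  ultimately have "exp (- 2 * s) \<le> 1 / 16" by simp
  then have z: "norm z \<le> 1 / 6" "norm z < 1 / 2" by (auto simp: z_def norm_minus_cancel)
  have e1: "1 - z = of_real (2 * exp (- s) * cosh s)" "1 + z = of_real (2 * exp (- s) * y)"
  proof -
    have "2 * exp (- s) * cosh s = 1 + exp (- 2 * s)" "2 * exp (- s) * sinh s = 1 - exp (- 2 * s)"
      by (simp_all add: cosh_field_def sinh_field_def algebra_simps diff_divide_distrib flip: exp_add)
    then show "1 - z = of_real (2 * exp (- s) * cosh s)" "1 + z = of_real (2 * exp (- s) * y)"
      unfolding sinh_s z_def by (simp_all only: of_real_add of_real_diff of_real_1) simp_all
  qed
  have ln1: "ln (2 * exp (- s) * cosh s) = ln 2 - s + L" "ln (2 * exp (- s) * y) = ln 2 - s + ln y"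
    using y by (simp_all add: ln_mult L_def)
  have w1: "(1 - z) powr w = exp (w * of_real (ln 2 - s + L))"
    and w2: "(1 + z) powr w = exp (w * of_real (ln 2 - s + ln y))" for w
    unfolding e1 using y by (simp_all only: of_real_powr ln1[symmetric] mult_pos_pos exp_gt_zero cosh_real_pos zero_less_numeral less_le_trans[of 0 2 y])
  have arg: "- z / (1 - z) = of_real (1 / (1 + exp (2 * s)))"
  proof -
    have "d > 0 \<Longrightarrow> inverse d / (1 + inverse d) = 1 / (1 + d)" for d :: real
      by (simp add: field_simps add_nonneg_eq_0_iff)
    from this[of "exp (2 * s)"] have "exp (- 2 * s) / (1 + exp (- 2 * s)) = 1 / (1 + exp (2 * s))"
      by (simp add: exp_minus)
    from this[symmetric] show ?thesis unfolding z_def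
      by (simp only: minus_minus diff_minus_eq_add of_real_divide of_real_add of_real_1)
  qed
  have "hyp2F1_reg a (- \<rho>) (1 + \<mu>) z = (\<Sum>k. t k)"
    using hyp2F1_reg_quadratic[OF z(1), of a "- \<rho>"] by (simp add: t_def a_def add_ac)
  moreover have "(1 - z) powr \<rho> * hyp2F1_reg (- \<rho>) (\<rho> + 1) (1 + \<mu>) (of_real (1 / (1 + exp (2 * s)))) = hyp2F1_reg a (- \<rho>) (1 + \<mu>) z"
    using hyp2F1_reg_pfaff[OF z(2), of "- \<rho>" "\<rho> + 1" "1 + \<mu>"] unfolding arg
    by (simp add: a_def hyp2F1_reg_commute[of "- \<rho>"])
  moreover have "(1 - z) powr \<rho> \<noteq> 0" unfolding w1 by simp
  ultimately have G: "ferrers_sinh \<mu> \<rho> y = c * (\<Sum>k. t k)"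
    by (simp add: ferrers_sinh_def ferrers_cosh_def s_def[symmetric] L_def[symmetric] c_def field_simps)
  have term_eq: "c * t k = infinity_coeff \<mu> \<rho> k * of_real y powr (- (\<mu> - \<rho> + of_nat (2 * k)))" for k
  proof -
    have zk: "z ^ k = (- 1) ^ k * exp (- of_nat k * (2 * of_real s))"
    proof -
      have "z ^ k = (- 1) ^ k * complex_of_real (exp (- 2 * s)) ^ k"
        unfolding z_def by (rule power_minus)
      also have "complex_of_real (exp (- 2 * s)) ^ k = exp (- of_nat k * (2 * of_real s))"
        by (simp add: exp_of_real[symmetric] exp_of_nat_mult[symmetric] mult_ac)
      finally show ?thesis .
    qed
    have qk: "(- 1 / 4 :: complex) ^ k = (- 1) ^ k * exp (- of_nat k * (2 * of_real (ln 2)))"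
    proof -
      have q4: "exp (- (2 * complex_of_real (ln 2))) = 1 / 4"
        by (simp add: exp_minus exp_double exp_of_real)
      have "exp (- of_nat k * (2 * complex_of_real (ln 2))) = (1 / 4) ^ k"
        unfolding q4[symmetric] exp_of_nat_mult[symmetric] by simp
      then show ?thesis using power_minus[of "1 / 4 :: complex" k] by simp
    qed
    have "2 powr (- \<mu>) = exp (- \<mu> * of_real (ln 2))" using of_real_powr[of 2 "- \<mu>"] by simp
    moreover have "of_real y powr (- (\<mu> - \<rho> + of_nat (2 * k))) = exp (- (a + of_nat (2 * k)) * of_real (ln y))"
      using y by (simp add: of_real_powr a_def)
    \<comment> \<open>The contributions of \<open>s\<close> and of L = \<open>ln (cosh s)\<close>
      cancel; only powers of 2 and of \<open>y\<close> survive.\<close>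
    moreover have "exp (\<rho> * of_real L - \<mu> * of_real s) / exp (\<rho> * of_real (ln 2 - s + L)) *
        (exp (- of_nat k * (2 * of_real s)) * exp (- (a + of_nat (2 * k)) * of_real (ln 2 - s + ln y)))
      = exp (- \<mu> * of_real (ln 2)) * exp (- of_nat k * (2 * of_real (ln 2))) * exp (- (a + of_nat (2 * k)) * of_real (ln y))"
      unfolding exp_diff[symmetric] exp_add[symmetric]
      by (rule arg_cong[where f = exp]) (simp add: a_def algebra_simps)
    ultimately show ?thesis
      unfolding c_def t_def infinity_coeff_def w1 w2 zk qk a_def[symmetric] by (simp add: field_simps)
  qed
  have "summable (\<lambda>k. c * t k)"
    unfolding term_eq
  proof (rule summable_norm_cancel)
    have "norm (infinity_coeff \<mu> \<rho> k * of_real y powr (- (\<mu> - \<rho> + of_nat (2 * k))))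
      = norm (of_real y powr (- (\<mu> - \<rho>))) * (norm (infinity_coeff \<mu> \<rho> k) * (1 / y\<^sup>2) ^ k)" for k
      using y by (subst of_real_powr_minus_even) (auto simp: norm_mult norm_power norm_divide)
    then show "summable (\<lambda>k. norm (infinity_coeff \<mu> \<rho> k * of_real y powr (- (\<mu> - \<rho> + of_nat (2 * k)))))"
      using summable_mult[OF infinity_coeff_summable[OF y]] by (simp only:)
  qed
  moreover have "c \<noteq> 0" unfolding c_def w1 by simp
  ultimately have "summable t" by (simp add: summable_cmult_iff)
  then have "(\<lambda>k. c * t k) sums (c * (\<Sum>k. t k))" by (intro sums_mult summable_sums)
  then show ?thesis unfolding term_eq G .
qed

lemma integrable_Beta_kernel:
  assumes "(c::real) > 0" "r > -1" "b > r + 1"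
  shows "set_integrable lborel {0<..} (\<lambda>v. (c + v) powr (- b) * v powr r)"
proof -
  have "set_integrable lborel {0<..} (\<lambda>v. norm (complex_of_real (c + v) powr (- of_real b) * of_real v powr of_real r))"
    by (rule set_integrable_norm) (use Beta_integral_Ioi(1)[of c "of_real r" "of_real b"] assms in simp)
  also have "?this \<longleftrightarrow> ?thesis"
    by (rule set_integrable_cong) (use assms in \<open>auto simp: norm_mult norm_powr_real_powr simp flip: of_real_add\<close>)
  finally show ?thesis .
qed

text \<open>Both sides equal Gamma(l + 1) Gamma(a - l - 1 + n) / Gamma(a). With a = \<mu> - \<rho>
  it converts coefficients belonging to degree \<rho> into those belonging to \<rho> + l +
  1.\<close>

lemma Beta_pochhammer:
  fixes a l :: complex
  assumes l: "Re l > -1" and a: "Re a > Re l + 1"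
  shows "pochhammer a n * Beta (l + 1) (a + of_nat n - l - 1) = Beta (l + 1) (a - l - 1) * pochhammer (a - l - 1) n"
proof -
  have nz: "w \<notin> \<int>\<^sub>\<le>\<^sub>0" if "Re w > 0" for w :: complex
    using that by (auto elim!: nonpos_Ints_cases)
  have 1: "pochhammer a n = Gamma (a + of_nat n) / Gamma a"
    using a l by (intro pochhammer_Gamma nz) simp
  have 2: "pochhammer (a - l - 1) n = Gamma (a - l - 1 + of_nat n) / Gamma (a - l - 1)"
    using a l by (intro pochhammer_Gamma nz) simp
  have "Gamma a \<noteq> 0" "Gamma (a + of_nat n) \<noteq> 0" "Gamma (a - l - 1) \<noteq> 0"
    using a l nz[of a] nz[of "a + of_nat n"] nz[of "a - l - 1"] by (auto simp: Gamma_eq_zero_iff)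
  moreover have "a + of_nat n - l - 1 = a - l - 1 + of_nat n" by simp
  ultimately show ?thesis unfolding 1 2 Beta_def by (simp add: field_simps)
qed

text \<open>The left side is \<open>Gamma (l + 1)\<close> times the Weyl integral of order l + 1. A
  predicate is convenient because the descent carries it for all degrees \<rho> - j
  together.\<close>

definition weyl_identity :: "complex \<Rightarrow> complex \<Rightarrow> complex \<Rightarrow> real \<Rightarrow> bool" where
  "weyl_identity \<mu> l \<rho> x \<longleftrightarrow>
     (LINT v:{0<..}|lborel. ferrers_sinh \<mu> \<rho> (x + v) * of_real v powr l)
       = Beta (l + 1) (\<mu> - \<rho> - l - 1) * ferrers_sinh \<mu> (\<rho> + l + 1) x"

lemma continuous_on_ferrers_sinh_shift:
  "continuous_on {0<..} (\<lambda>v. ferrers_sinh \<mu> \<rho> (x + v) * of_real v powr l)"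
  by (intro continuous_intros continuous_on_compose2[OF continuous_on_ferrers_sinh[of UNIV]]) auto

lemma set_borel_measurable_continuous_Ioi:
  fixes f :: "real \<Rightarrow> complex"
  assumes "continuous_on {0<..} f"
  shows "set_borel_measurable lborel {0<..} f"
  using borel_measurable_continuous_on_indicator[OF _ assms] by (simp add: set_borel_measurable_def)

lemma ferrers_sinh_weyl_integrable:
  assumes l: "Re l > -1" and b: "Re (\<mu> - \<rho>) > Re l + 1"
  shows "set_integrable lborel {0<..} (\<lambda>v. ferrers_sinh \<mu> \<rho> (x + v) * of_real v powr l)"
proof -
  have "Re (\<mu> - \<rho>) > 0" using l b by simp
  then obtain C R where C: "C > 0" "R \<ge> 1"
    "\<And>k v. v \<ge> 0 \<Longrightarrow> norm (ferrers_sinh \<mu> (\<rho> - of_nat k) (x + v)) \<le> C * R ^ k * (1 + v) powr (- Re (\<mu> - \<rho>))"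
    by (rule ferrers_sinh_bound[of \<mu> \<rho> x]) (rule that)
  have "set_integrable lborel {0<..} (\<lambda>v. C * ((1 + v) powr (- Re (\<mu> - \<rho>)) * v powr Re l))"
    using integrable_Beta_kernel[of 1 "Re l" "Re (\<mu> - \<rho>)"] l b by (intro set_integrable_mult_right) auto
  then show ?thesis
  proof (rule set_integrable_bound)
    show "set_borel_measurable lborel {0<..} (\<lambda>v. ferrers_sinh \<mu> \<rho> (x + v) * of_real v powr l)"
      by (intro set_borel_measurable_continuous_Ioi continuous_on_ferrers_sinh_shift)
    have "norm (ferrers_sinh \<mu> \<rho> (x + v) * of_real v powr l) \<le> C * ((1 + v) powr (- Re (\<mu> - \<rho>)) * v powr Re l)"
      if "v > 0" for v
      using mult_right_mono[OF C(3)[of v 0], of "v powr Re l"] that by (simp add: norm_mult norm_powr_real_powr mult_ac)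
    then show "AE v in lborel. v \<in> {0<..} \<longrightarrow> norm (ferrers_sinh \<mu> \<rho> (x + v) * of_real v powr l)
        \<le> norm (C * ((1 + v) powr (- Re (\<mu> - \<rho>)) * v powr Re l))"
      using C(1) by (intro AE_I2) auto
  qed
qed

text \<open>Each power in the expansion at infinity integrates to a Beta value, and
  \<open>Beta_pochhammer\<close> with n = 2k yields the expansion for degree \<rho> + l + 1.
  Domination is simple: (x + v)^(-2k) \<le> x^(-2k) leaves one fixed integrable kernel.\<close>

lemma weyl_identity_large:
  assumes l: "Re l > -1" and b: "Re (\<mu> - \<rho>) > Re l + 1" and x: "x \<ge> 2"
  shows "weyl_identity \<mu> l \<rho> x"
proof -
  define a where "a = \<mu> - \<rho>"
  define f where "f k v = infinity_coeff \<mu> \<rho> k * (of_real (x + v) powr (- (a + of_nat (2 * k))) * of_real v powr l)" for k :: nat and v :: real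
  have int: "set_integrable lborel {0<..} (\<lambda>v. (x + v) powr (- Re a) * v powr Re l)"
    using integrable_Beta_kernel[of x "Re l" "Re a"] l b x by (simp add: a_def)
  have meas: "set_borel_measurable lborel {0<..} (f k)" for k
    unfolding f_def using x by (intro set_borel_measurable_continuous_Ioi continuous_intros) (auto simp flip: of_real_add)
  have bd: "norm (f k v) \<le> norm (infinity_coeff \<mu> \<rho> k) * (1 / x\<^sup>2) ^ k * ((x + v) powr (- Re a) * v powr Re l)"
    if "v \<in> {0<..}" for k v
  proof -
    have v: "v > 0" using that by simp
    have "norm (f k v) = norm (infinity_coeff \<mu> \<rho> k) * (1 / (x + v)\<^sup>2) ^ k * ((x + v) powr (- Re a) * v powr Re l)"
      unfolding f_def using v x
      by (subst of_real_powr_minus_even) (auto simp: norm_mult norm_power norm_divide norm_powr_real_powr power_abs simp flip: of_real_add)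
    also have "\<dots> \<le> norm (infinity_coeff \<mu> \<rho> k) * (1 / x\<^sup>2) ^ k * ((x + v) powr (- Re a) * v powr Re l)"
      using v x by (intro mult_right_mono mult_left_mono power_mono divide_left_mono) auto
    finally show ?thesis .
  qed
  have sum_f: "(\<Sum>k. f k v) = ferrers_sinh \<mu> \<rho> (x + v) * of_real v powr l" if "v \<in> {0<..}" for v
    using sums_mult2[OF ferrers_sinh_expansion[of "x + v" \<mu> \<rho>], of "of_real v powr l"] that x
    by (simp add: f_def a_def sums_iff mult_ac)
  have "(\<lambda>k. LINT v:{0<..}|lborel. f k v) sums (LINT v:{0<..}|lborel. (\<Sum>k. f k v))"
    by (rule set_integral_sums_dominated(2)[OF _ int meas bd infinity_coeff_summable[OF x]]) auto
  also have "(LINT v:{0<..}|lborel. (\<Sum>k. f k v)) = (LINT v:{0<..}|lborel. ferrers_sinh \<mu> \<rho> (x + v) * of_real v powr l)"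
    by (rule set_lebesgue_integral_cong) (use sum_f in auto)
  also have "(\<lambda>k. LINT v:{0<..}|lborel. f k v)
    = (\<lambda>k. Beta (l + 1) (a - l - 1) * (infinity_coeff \<mu> (\<rho> + l + 1) k * of_real x powr (- (\<mu> - (\<rho> + l + 1) + of_nat (2 * k)))))"
  proof
    fix k
    have "(LINT v:{0<..}|lborel. f k v) = infinity_coeff \<mu> \<rho> k * (Beta (l + 1) (a + of_nat (2 * k) - l - 1) * of_real x powr (l + 1 - (a + of_nat (2 * k))))"
      unfolding f_def set_integral_mult_right using Beta_integral_Ioi(2)[of x l "a + of_nat (2 * k)"] l b x by (simp add: a_def)
    also have "infinity_coeff \<mu> \<rho> k * (Beta (l + 1) (a + of_nat (2 * k) - l - 1) * of_real x powr (l + 1 - (a + of_nat (2 * k))))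
      = 2 powr (- \<mu>) * (- 1 / 4) ^ k * (pochhammer a (2 * k) * Beta (l + 1) (a + of_nat (2 * k) - l - 1)) * rGamma (1 + \<mu> + of_nat k) / fact k * of_real x powr (l + 1 - (a + of_nat (2 * k)))"
      by (simp add: infinity_coeff_def a_def)
    also have "pochhammer a (2 * k) * Beta (l + 1) (a + of_nat (2 * k) - l - 1) = Beta (l + 1) (a - l - 1) * pochhammer (a - l - 1) (2 * k)"
      using l b by (intro Beta_pochhammer) (auto simp: a_def)
    finally show "(LINT v:{0<..}|lborel. f k v) = Beta (l + 1) (a - l - 1) * (infinity_coeff \<mu> (\<rho> + l + 1) k * of_real x powr (- (\<mu> - (\<rho> + l + 1) + of_nat (2 * k))))"
      by (simp add: infinity_coeff_def a_def algebra_simps)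
  qed
  finally have "(\<lambda>k. Beta (l + 1) (a - l - 1) * (infinity_coeff \<mu> (\<rho> + l + 1) k * of_real x powr (- (\<mu> - (\<rho> + l + 1) + of_nat (2 * k)))))
     sums (LINT v:{0<..}|lborel. ferrers_sinh \<mu> \<rho> (x + v) * of_real v powr l)" .
  moreover have "(\<lambda>k. Beta (l + 1) (a - l - 1) * (infinity_coeff \<mu> (\<rho> + l + 1) k * of_real x powr (- (\<mu> - (\<rho> + l + 1) + of_nat (2 * k)))))
     sums (Beta (l + 1) (a - l - 1) * ferrers_sinh \<mu> (\<rho> + l + 1) x)"
    by (rule sums_mult[OF ferrers_sinh_expansion[OF x]])
  ultimately show ?thesis unfolding weyl_identity_def a_def by (rule sums_unique2)
qed

text \<open>Expand the integrand at x - h + v about x + v and integrate term by term. Term k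
  involves degree \<rho> - (j + k), so \<open>P\<close> is required for all degrees;
  \<open>Beta_pochhammer\<close> then recombines the result into the Taylor series of the right side
  about x. The bounds are anchored at a fixed \<open>x0\<close> so that R, and with it h, need not
  change from step to step.\<close>

lemma weyl_identity_step:
  assumes l: "Re l > -1" and b: "Re (\<mu> - \<rho>) > Re l + 1"
    and h: "h \<ge> 0" "h * R < 1" "x0 \<le> x - h" and R: "R \<ge> 1" and C: "C \<ge> 0"
    and bd1: "\<And>k v. v \<ge> 0 \<Longrightarrow>
      norm (ferrers_sinh \<mu> (\<rho> - of_nat k) (x0 + v)) \<le> C * R ^ k * (1 + v) powr (- Re (\<mu> - \<rho>))"
    and bd2: "\<And>k v. v \<ge> 0 \<Longrightarrow> norm (ferrers_sinh \<mu> (\<rho> + l + 1 - of_nat k) (x0 + v)) \<le> C * R ^ k"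
    and P: "\<And>j. weyl_identity \<mu> l (\<rho> - of_nat j) x"
  shows "weyl_identity \<mu> l (\<rho> - of_nat j) (x - h)"
proof -
  define a where "a = \<mu> - \<rho> + of_nat j"
  define b where "b = Re (\<mu> - \<rho>)"
  have ab: "Re a > Re l + 1" using b by (simp add: a_def)
  have shift: "\<rho> - of_nat j - of_nat k = \<rho> - of_nat (j + k)" for k by simp
  define f where "f k v = pochhammer a k / fact k * of_real h ^ k *
      (ferrers_sinh \<mu> (\<rho> - of_nat (j + k)) (x + v) * of_real v powr l)" for k v
  define c where "c k = C * R ^ j * (pochhammer (norm a) k / fact k * (h * R) ^ k)" for k
  have hR: "\<bar>h * R\<bar> < 1" using h R by simp
  have summable_c: "summable c"
    unfolding c_def using pochhammer_binomial_sums_real[OF hR, of "norm a"]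
    by (intro summable_mult) (simp add: sums_iff)
  \<comment> \<open>The shift by x - x0 appears because \<open>bd1\<close> measures the distance
    from \<open>x0\<close>, and x + v = x0 + (x - x0 + v).\<close>
  have int: "set_integrable lborel {0<..} (\<lambda>v. (1 + (x - x0) + v) powr (- b) * v powr Re l)"
    using integrable_Beta_kernel[of "1 + (x - x0)" "Re l" b] l assms(2) h by (simp add: b_def)
  have meas: "set_borel_measurable lborel {0<..} (f k)" for k
    unfolding f_def
    by (intro set_borel_measurable_continuous_Ioi continuous_on_mult_left continuous_on_ferrers_sinh_shift)
  have bd: "norm (f k v) \<le> c k * ((1 + (x - x0) + v) powr (- b) * v powr Re l)" if "v \<in> {0<..}" for k v
  proof -
    have v: "v > 0" using that by simp
    have "norm (ferrers_sinh \<mu> (\<rho> - of_nat (j + k)) (x + v)) \<le> C * R ^ (j + k) * (1 + (x - x0) + v) powr (- b)"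
      using bd1[of "x - x0 + v" "j + k"] v h by (simp add: b_def add_ac)
    moreover have "norm (pochhammer a k) / fact k \<le> pochhammer (norm a) k / fact k"
      by (intro divide_right_mono norm_pochhammer_le) auto
    ultimately have "norm (f k v) \<le> pochhammer (norm a) k / fact k * h ^ k * ((C * R ^ (j + k) * (1 + (x - x0) + v) powr (- b)) * v powr Re l)"
      unfolding f_def norm_mult norm_divide norm_power using v h R C
      by (intro mult_mono)
        (auto simp: norm_powr_real_powr pochhammer_ge_0 simp del: of_nat_add intro!: mult_nonneg_nonneg)
    then show ?thesis by (simp add: c_def power_add power_mult_distrib mult_ac)
  qed
  have sum_f: "(\<Sum>k. f k v) = ferrers_sinh \<mu> (\<rho> - of_nat j) (x - h + v) * of_real v powr l" if "v \<in> {0<..}" for v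
  proof -
    have v: "v > 0" using that by simp
    have "(\<lambda>k. pochhammer (\<mu> - (\<rho> - of_nat j)) k / fact k * of_real h ^ k * ferrers_sinh \<mu> (\<rho> - of_nat j - of_nat k) (x + v))
       sums ferrers_sinh \<mu> (\<rho> - of_nat j) (x + v - h)"
    proof (rule ferrers_sinh_taylor[OF h(1,2)])
      fix k t assume t: "x + v - h \<le> t" "t \<le> x + v"
      have "norm (ferrers_sinh \<mu> (\<rho> - of_nat (j + k)) t) \<le> C * R ^ (j + k) * (1 + (t - x0)) powr (- b)"
        using bd1[of "t - x0" "j + k"] t v h by (simp add: b_def)
      also have "\<dots> \<le> C * R ^ (j + k) * 1"
      proof -
        have "(1 + (t - x0)) powr (- b) \<le> (1 + (t - x0)) powr 0"
          using t v h assms(1,2) by (intro powr_mono) (auto simp: b_def)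
        then show ?thesis using C R t v h by (intro mult_left_mono) auto
      qed
      finally show "norm (ferrers_sinh \<mu> (\<rho> - of_nat j - of_nat k) t) \<le> C * R ^ j * R ^ k"
        unfolding shift by (simp add: power_add mult_ac)
    qed (use R in auto)
    moreover have "\<mu> - (\<rho> - of_nat j) = a" "x + v - h = x - h + v" by (simp_all add: a_def)
    ultimately have "(\<lambda>k. pochhammer a k / fact k * of_real h ^ k * ferrers_sinh \<mu> (\<rho> - of_nat (j + k)) (x + v))
       sums ferrers_sinh \<mu> (\<rho> - of_nat j) (x - h + v)"
      unfolding shift by (simp only:)
    from sums_mult2[OF this, of "of_real v powr l"] show ?thesis
      unfolding f_def by (simp only: sums_iff mult.assoc)
  qed
  have "(\<lambda>k. LINT v:{0<..}|lborel. f k v) sums (LINT v:{0<..}|lborel. (\<Sum>k. f k v))"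
    by (rule set_integral_sums_dominated(2)[OF _ int meas bd summable_c]) auto
  also have "(LINT v:{0<..}|lborel. (\<Sum>k. f k v)) = (LINT v:{0<..}|lborel. ferrers_sinh \<mu> (\<rho> - of_nat j) (x - h + v) * of_real v powr l)"
    by (rule set_lebesgue_integral_cong) (use sum_f in auto)
  also have "(\<lambda>k. LINT v:{0<..}|lborel. f k v)
     = (\<lambda>k. Beta (l + 1) (a - l - 1) * (pochhammer (\<mu> - (\<rho> - of_nat j + l + 1)) k / fact k * of_real h ^ k *
         ferrers_sinh \<mu> (\<rho> - of_nat j + l + 1 - of_nat k) x))"
  proof
    fix k
    have "(LINT v:{0<..}|lborel. f k v) = pochhammer a k / fact k * of_real h ^ k *
        (Beta (l + 1) (a + of_nat k - l - 1) * ferrers_sinh \<mu> (\<rho> - of_nat (j + k) + l + 1) x)"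
      unfolding f_def set_integral_mult_right using P[of "j + k"] unfolding weyl_identity_def
      by (simp add: a_def algebra_simps)
    also have "\<dots> = (pochhammer a k * Beta (l + 1) (a + of_nat k - l - 1)) / fact k * of_real h ^ k * ferrers_sinh \<mu> (\<rho> - of_nat (j + k) + l + 1) x"
      by simp
    also have "pochhammer a k * Beta (l + 1) (a + of_nat k - l - 1) = Beta (l + 1) (a - l - 1) * pochhammer (a - l - 1) k"
      using l ab by (rule Beta_pochhammer)
    finally show "(LINT v:{0<..}|lborel. f k v) = Beta (l + 1) (a - l - 1) * (pochhammer (\<mu> - (\<rho> - of_nat j + l + 1)) k / fact k * of_real h ^ k *
         ferrers_sinh \<mu> (\<rho> - of_nat j + l + 1 - of_nat k) x)"
      by (simp add: a_def algebra_simps)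
  qed
  finally have 1: "(\<lambda>k. Beta (l + 1) (a - l - 1) * (pochhammer (\<mu> - (\<rho> - of_nat j + l + 1)) k / fact k * of_real h ^ k *
         ferrers_sinh \<mu> (\<rho> - of_nat j + l + 1 - of_nat k) x))
     sums (LINT v:{0<..}|lborel. ferrers_sinh \<mu> (\<rho> - of_nat j) (x - h + v) * of_real v powr l)" .
  have shift': "\<rho> - of_nat j + l + 1 - of_nat k = \<rho> + l + 1 - of_nat (j + k)" for k by simp
  have "(\<lambda>k. pochhammer (\<mu> - (\<rho> - of_nat j + l + 1)) k / fact k * of_real h ^ k *
         ferrers_sinh \<mu> (\<rho> - of_nat j + l + 1 - of_nat k) x) sums ferrers_sinh \<mu> (\<rho> - of_nat j + l + 1) (x - h)"
  proof (rule ferrers_sinh_taylor[OF h(1,2)])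
    fix k t assume "x - h \<le> t" "t \<le> x"
    then show "norm (ferrers_sinh \<mu> (\<rho> - of_nat j + l + 1 - of_nat k) t) \<le> C * R ^ j * R ^ k"
      unfolding shift' using bd2[of "t - x0" "j + k"] h by (simp add: power_add mult_ac)
  qed (use R in auto)
  then have 2: "(\<lambda>k. Beta (l + 1) (a - l - 1) * (pochhammer (\<mu> - (\<rho> - of_nat j + l + 1)) k / fact k * of_real h ^ k *
         ferrers_sinh \<mu> (\<rho> - of_nat j + l + 1 - of_nat k) x))
     sums (Beta (l + 1) (a - l - 1) * ferrers_sinh \<mu> (\<rho> - of_nat j + l + 1) (x - h))"
    by (rule sums_mult)
  have "\<mu> - (\<rho> - of_nat j) - l - 1 = a - l - 1" by (simp add: a_def)
  then show ?thesis unfolding weyl_identity_def using sums_unique2[OF 1 2] by (simp only:)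
qed

text \<open>The target point \<open>x\<close> itself anchors the bounds for both families of
  degrees, so one R governs the whole descent from 2 down to \<open>x\<close>.\<close>

lemma weyl_identity:
  assumes l: "Re l > -1" and b: "Re (\<mu> - \<rho>) > Re l + 1"
  shows "weyl_identity \<mu> l \<rho> x"
proof -
  have "Re (\<mu> - \<rho>) > 0" using l b by simp
  then obtain C1 R1 where 1: "C1 > 0" "R1 \<ge> 1"
    "\<And>k v. v \<ge> 0 \<Longrightarrow> norm (ferrers_sinh \<mu> (\<rho> - of_nat k) (x + v)) \<le> C1 * R1 ^ k * (1 + v) powr (- Re (\<mu> - \<rho>))"
    by (rule ferrers_sinh_bound[of \<mu> \<rho> x]) (rule that)
  have b2: "Re (\<mu> - (\<rho> + l + 1)) > 0" using b by simp
  then obtain C2 R2 where 2: "C2 > 0" "R2 \<ge> 1"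
    "\<And>k v. v \<ge> 0 \<Longrightarrow> norm (ferrers_sinh \<mu> (\<rho> + l + 1 - of_nat k) (x + v)) \<le> C2 * R2 ^ k * (1 + v) powr (- Re (\<mu> - (\<rho> + l + 1)))"
    by (rule ferrers_sinh_bound[of \<mu> "\<rho> + l + 1" x]) (rule that)
  define C where "C = max C1 C2"
  define R where "R = max R1 R2"
  have CR: "C \<ge> 0" "R \<ge> 1" "C1 \<le> C" "C2 \<le> C" "R1 \<le> R" "R2 \<le> R"
    using 1(1,2) 2(1,2) by (auto simp: C_def R_def)
  have bd1: "norm (ferrers_sinh \<mu> (\<rho> - of_nat k) (x + v)) \<le> C * R ^ k * (1 + v) powr (- Re (\<mu> - \<rho>))" if "v \<ge> 0" for k v
    using that CR 1(1,2) by (intro order_trans[OF 1(3)] mult_right_mono mult_mono power_mono) auto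
  have bd2: "norm (ferrers_sinh \<mu> (\<rho> + l + 1 - of_nat k) (x + v)) \<le> C * R ^ k" if "v \<ge> 0" for k v
  proof -
    have "(1 + v) powr (- Re (\<mu> - (\<rho> + l + 1))) \<le> (1 + v) powr 0"
      using that b2 by (intro powr_mono) auto
    then have "C2 * R2 ^ k * (1 + v) powr (- Re (\<mu> - (\<rho> + l + 1))) \<le> C * R ^ k * 1"
      using that CR 2(1,2) by (intro mult_mono power_mono) auto
    then show ?thesis using 2(3)[OF that, of k] by simp
  qed
  \<comment> \<open>Any positive step below 1/R would do.\<close>
  define h where "h = 1 / (2 * R)"
  have h: "h > 0" "h * R < 1" using CR by (auto simp: h_def)
  \<comment> \<open>If \<open>y\<close> satisfies the condition for n + 1, then \<open>y + h\<close>
    satisfies it for n. All degrees \<rho> - j are carried along, as the step consumes them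
    all.\<close>
  have step: "\<forall>y j. x \<le> y \<longrightarrow> 2 - real n * h \<le> y \<longrightarrow> weyl_identity \<mu> l (\<rho> - of_nat j) y" for n
  proof (induction n)
    case 0
    show ?case using l b by (auto intro!: weyl_identity_large)
  next
    case (Suc n)
    show ?case
    proof (intro allI impI)
      fix y j assume y: "x \<le> y" "2 - real (Suc n) * h \<le> y"
      have "weyl_identity \<mu> l (\<rho> - of_nat j) (y + h - h)"
      proof (rule weyl_identity_step[where ?x0.0 = x and C = C and R = R, OF l b])
        show "weyl_identity \<mu> l (\<rho> - of_nat j) (y + h)" for j
          using Suc.IH y h by (simp add: algebra_simps)
      qed (use bd1 bd2 y h CR in auto)
      then show "weyl_identity \<mu> l (\<rho> - of_nat j) y" by simp
    qed
  qed
  obtain n where "(2 - x) / h \<le> real n" using real_arch_simple by blast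
  then have "2 - real n * h \<le> x" using h by (simp add: field_simps)
  then show ?thesis using step[of n] by (metis diff_zero of_nat_0 order_refl)
qed

section \<open>The two integral formulas in the variable s\<close>

lemma ferrers_sinh_sinh: "ferrers_sinh \<mu> \<rho> (sinh s) = of_real (cosh s) powr \<rho> * ferrers_P \<rho> (- \<mu>) (tanh s)"
  by (simp add: ferrers_sinh_def ferrers_cosh_eq arsinh_sinh_real)

text \<open>The Jacobian of v = sinh s - sinh \<alpha> is cosh s, which raises cosh^\<rho> to
  cosh^(\<rho>+1). The Gamma quotient is the reciprocal of the Beta value in
  \<open>weyl_identity\<close>.\<close>

lemma ferrers_weyl_integral:
  fixes \<alpha> :: real
  assumes b: "Re (\<mu> - \<rho>) > Re l + 1" and l: "Re l + 1 > 0"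
  defines "f \<equiv> \<lambda>s. ferrers_P \<rho> (- \<mu>) (tanh s) * complex_of_real (cosh s) powr (\<rho> + 1) *
              complex_of_real (sinh s - sinh \<alpha>) powr l"
  shows "set_integrable lborel {\<alpha><..} f"
    and "of_real (cosh \<alpha>) powr (l + \<rho> + 1) * ferrers_P (l + \<rho> + 1) (- \<mu>) (tanh \<alpha>) =
       Gamma (\<mu> - \<rho>) / (Gamma (1 + l) * Gamma (\<mu> - l - \<rho> - 1)) * (LINT s:{\<alpha><..}|lborel. f s)"
proof -
  have l': "Re l > -1" using l by simp
  let ?F = "\<lambda>v. ferrers_sinh \<mu> \<rho> (sinh \<alpha> + v) * of_real v powr l"
  have img: "(\<lambda>s. sinh s - sinh \<alpha>) ` {\<alpha><..} = {0<..}"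
  proof (intro equalityI subsetI)
    fix v :: real assume "v \<in> {0<..}"
    then have "\<alpha> < arsinh (sinh \<alpha> + v)"
      using arsinh_less_iff_real[of "sinh \<alpha>" "sinh \<alpha> + v"] by (simp add: arsinh_sinh_real)
    then show "v \<in> (\<lambda>s. sinh s - sinh \<alpha>) ` {\<alpha><..}" by (intro image_eqI[of _ _ "arsinh (sinh \<alpha> + v)"]) auto
  qed auto
  note sub = set_integral_subst_Ioi[of \<alpha> "\<lambda>s. sinh s - sinh \<alpha>" cosh, OF _ _ img
      continuous_on_ferrers_sinh_shift _ ferrers_sinh_weyl_integrable[OF l' b]]
  have eq: "of_real (cosh s) * ?F (sinh s - sinh \<alpha>) = f s" for s
    by (simp add: f_def ferrers_sinh_sinh powr_add mult_ac)
  have "set_integrable lborel {\<alpha><..} (\<lambda>s. of_real (cosh s) * ?F (sinh s - sinh \<alpha>))"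
    by (rule sub(1)) (auto intro!: derivative_eq_intros continuous_intros)
  then show "set_integrable lborel {\<alpha><..} f" unfolding eq .
  have "(LINT s:{\<alpha><..}|lborel. of_real (cosh s) * ?F (sinh s - sinh \<alpha>)) = (LINT v:{0<..}|lborel. ?F v)"
    by (rule sub(2)) (auto intro!: derivative_eq_intros continuous_intros)
  then have I: "(LINT s:{\<alpha><..}|lborel. f s) = Beta (l + 1) (\<mu> - \<rho> - l - 1) * ferrers_sinh \<mu> (\<rho> + l + 1) (sinh \<alpha>)"
    using weyl_identity[OF l' b, of "sinh \<alpha>"] unfolding eq weyl_identity_def by simp
  have "Gamma w \<noteq> 0" if "Re w > 0" for w :: complex
    using that by (auto simp: Gamma_eq_zero_iff elim!: nonpos_Ints_cases)
  then have "Gamma (\<mu> - \<rho>) \<noteq> 0" "Gamma (l + 1) \<noteq> 0" "Gamma (\<mu> - \<rho> - l - 1) \<noteq> 0"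
    using b l by auto
  moreover have p: "l + \<rho> + 1 = \<rho> + l + 1" "1 + l = l + 1" "\<mu> - l - \<rho> - 1 = \<mu> - \<rho> - l - 1"
      "l + 1 + (\<mu> - \<rho> - l - 1) = \<mu> - \<rho>" by simp_all
  ultimately show "of_real (cosh \<alpha>) powr (l + \<rho> + 1) * ferrers_P (l + \<rho> + 1) (- \<mu>) (tanh \<alpha>) =
       Gamma (\<mu> - \<rho>) / (Gamma (1 + l) * Gamma (\<mu> - l - \<rho> - 1)) * (LINT s:{\<alpha><..}|lborel. f s)"
    unfolding I ferrers_sinh_sinh Beta_def p by simp
qed

text \<open>In the variable v the argument of the series is
  \<open>\<zeta> \<alpha> / (1 + v)\<close>, and term k yields Beta(l + 1, 1 + \<mu> + k). Its
  numerator Gamma(1 + \<mu> + k) cancels the \<open>rGamma\<close> of the series and its denominator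
  installs Gamma(\<mu> + l + 2 + k): the lower parameter moves from 1 + \<mu> to \<mu> + l +
  2.\<close>

lemma ferrers_tanh_integral:
  fixes \<alpha> :: real and \<mu> \<nu> l :: complex
  assumes \<mu>: "Re \<mu> > -1" and l: "Re l > -1"
  defines "f \<equiv> \<lambda>s. complex_of_real (cosh s) powr (- \<mu> - 2) * ferrers_P \<nu> (- \<mu>) (tanh s) *
              complex_of_real (tanh s - tanh \<alpha>) powr l"
  shows "set_integrable lborel {\<alpha><..} f"
    and "ferrers_P \<nu> (- \<mu> - l - 1) (tanh \<alpha>) / of_real (cosh \<alpha>) powr (\<mu> + l + 1) =
       1 / Gamma (l + 1) * (LINT s:{\<alpha><..}|lborel. f s)"
proof -
  \<comment> \<open>This is (1 - tanh s) / 2, the argument of the hypergeometric series.\<close>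
  define \<zeta> where "\<zeta> s = 1 / (1 + exp (2 * s))" for s :: real
  define p where "p = hyp_coeff (- \<nu>) (\<nu> + 1) (1 + \<mu>)"
  define F where "F = hyp2F1_reg (- \<nu>) (\<nu> + 1) (1 + \<mu>)"
  have e: "1 + exp (2 * s) > 0" for s :: real by (simp add: add_pos_pos)
  have \<zeta>: "0 < \<zeta> s" "\<zeta> s < 1" for s
    using norm_ferrers_arg[of s] e[of s] unfolding norm_of_real \<zeta>_def by (auto simp: abs_less_iff)
  have ln_\<zeta>: "ln (2 * \<zeta> s) = - s - ln (cosh s)" for s
  proof -
    have "2 * (1 / d) = a / c" if "c * 2 = a * d" "d > 0" "c > 0" for a c d :: real
      using that by (simp add: field_simps)
    moreover have "cosh s * 2 = exp (- s) * (1 + exp (2 * s))"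
      by (simp add: cosh_field_def algebra_simps flip: exp_add)
    ultimately have "2 * \<zeta> s = exp (- s) / cosh s" unfolding \<zeta>_def using e[of s] cosh_real_pos by blast
    then show ?thesis by (simp add: ln_div)
  qed
  define t where "t k v = p k * of_real (\<zeta> \<alpha> ^ k) * (of_real (1 + v) powr (- (\<mu> + l + 2 + of_nat k)) * of_real v powr l)" for k and v :: real
  define \<phi> where "\<phi> v = F (of_real (\<zeta> \<alpha> / (1 + v))) * (of_real (1 + v) powr (- (\<mu> + l + 2)) * of_real v powr l)" for v :: real
  have small: "norm (complex_of_real (\<zeta> \<alpha> / (1 + v))) < 1" if "v > 0" for v
    using \<zeta>[of \<alpha>] that unfolding norm_of_real by (simp add: abs_of_pos divide_less_eq)
  have sum_t: "(\<Sum>k. t k v) = \<phi> v" if "v \<in> {0<..}" for v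
  proof -
    have v: "v > 0" using that by simp
    have t: "t k v = p k * of_real (\<zeta> \<alpha> / (1 + v)) ^ k * (of_real (1 + v) powr (- (\<mu> + l + 2)) * of_real v powr l)" for k
    proof -
      have "- (\<mu> + l + 2 + of_nat k) = - (\<mu> + l + 2) - of_nat k" by simp
      moreover have "complex_of_real (1 + v) powr of_nat k = of_real (1 + v) ^ k"
        using v unfolding of_real_eq_0_iff by (intro powr_nat') (simp add: complex_eq_iff)
      ultimately show ?thesis unfolding t_def by (simp only: powr_diff) (simp add: power_divide)
    qed
    have "(\<lambda>k. p k * of_real (\<zeta> \<alpha> / (1 + v)) ^ k) sums F (of_real (\<zeta> \<alpha> / (1 + v)))"
      unfolding F_def hyp2F1_reg_eq p_def by (intro summable_sums hyp2F1_reg_summable small v)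
    from sums_mult2[OF this] show ?thesis unfolding t \<phi>_def by (simp only: sums_iff)
  qed
  have int: "set_integrable lborel {0<..} (\<lambda>v. (1 + v) powr (- Re (\<mu> + l + 2)) * v powr Re l)"
    using integrable_Beta_kernel[of 1 "Re l" "Re (\<mu> + l + 2)"] \<mu> l by simp
  have meas: "set_borel_measurable lborel {0<..} (t k)" for k
    unfolding t_def by (intro set_borel_measurable_continuous_Ioi continuous_intros) (auto simp: complex_nonpos_Reals_iff complex_eq_iff)
  have bd: "norm (t k v) \<le> norm (p k) * \<zeta> \<alpha> ^ k * ((1 + v) powr (- Re (\<mu> + l + 2)) * v powr Re l)" if "v \<in> {0<..}" for k v
  proof -
    have v: "v > 0" using that by simp
    have "norm (t k v) = norm (p k) * \<zeta> \<alpha> ^ k * ((1 + v) powr (- Re (\<mu> + l + 2 + of_nat k)) * v powr Re l)"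
      unfolding t_def norm_mult norm_of_real using v \<zeta>[of \<alpha>]
      by (simp add: norm_powr_real_powr power_abs)
    also have "\<dots> \<le> norm (p k) * \<zeta> \<alpha> ^ k * ((1 + v) powr (- Re (\<mu> + l + 2)) * v powr Re l)"
      using v \<zeta>[of \<alpha>] by (intro mult_left_mono mult_right_mono powr_mono) auto
    finally show ?thesis .
  qed
  have sp: "summable (\<lambda>k. norm (p k) * \<zeta> \<alpha> ^ k)"
    unfolding p_def using \<zeta>[of \<alpha>] by (intro hyp_coeff_summable) auto
  note dom = set_integral_sums_dominated[OF _ int meas bd sp]
  have int_\<phi>: "set_integrable lborel {0<..} \<phi>"
    using dom(1) by (subst set_integrable_cong[OF refl refl sum_t[symmetric]]) auto
  have "(\<lambda>k. LINT v:{0<..}|lborel. t k v) sums (LINT v:{0<..}|lborel. (\<Sum>k. t k v))"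
    by (rule dom(2)) auto
  also have "(LINT v:{0<..}|lborel. (\<Sum>k. t k v)) = (LINT v:{0<..}|lborel. \<phi> v)"
    by (rule set_lebesgue_integral_cong) (use sum_t in auto)
  also have "(\<lambda>k. LINT v:{0<..}|lborel. t k v) = (\<lambda>k. Gamma (l + 1) * (hyp_coeff (- \<nu>) (\<nu> + 1) (\<mu> + l + 2) k * of_real (\<zeta> \<alpha>) ^ k))"
  proof
    fix k
    have "(LINT v:{0<..}|lborel. t k v) = p k * of_real (\<zeta> \<alpha> ^ k) * Beta (l + 1) (1 + \<mu> + of_nat k)"
      unfolding t_def set_integral_mult_right using Beta_integral_Ioi(2)[of 1 l "\<mu> + l + 2 + of_nat k"] l \<mu>
      by (simp add: add_ac)
    also have "Beta (l + 1) (1 + \<mu> + of_nat k) = Gamma (l + 1) * Gamma (1 + \<mu> + of_nat k) * rGamma (\<mu> + l + 2 + of_nat k)"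
      by (simp add: Beta_altdef add_ac)
    also have "p k * of_real (\<zeta> \<alpha> ^ k) * (Gamma (l + 1) * Gamma (1 + \<mu> + of_nat k) * rGamma (\<mu> + l + 2 + of_nat k))
        = Gamma (l + 1) * ((rGamma (1 + \<mu> + of_nat k) * Gamma (1 + \<mu> + of_nat k)) * (pochhammer (- \<nu>) k * pochhammer (\<nu> + 1) k * rGamma (\<mu> + l + 2 + of_nat k) / fact k) * of_real (\<zeta> \<alpha>) ^ k)"
      by (simp add: p_def hyp_coeff_def)
    \<comment> \<open>Re \<mu> > -1 keeps 1 + \<mu> + k away from the poles, where this product
      would be 0.\<close>
    also have "rGamma (1 + \<mu> + of_nat k) * Gamma (1 + \<mu> + of_nat k) = 1"
    proof -
      have "1 + \<mu> + of_nat k \<notin> \<int>\<^sub>\<le>\<^sub>0" using \<mu> by (auto elim!: nonpos_Ints_cases simp: complex_eq_iff)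
      then show ?thesis by (simp add: Gamma_def rGamma_eq_zero_iff)
    qed
    finally show "(LINT v:{0<..}|lborel. t k v) = Gamma (l + 1) * (hyp_coeff (- \<nu>) (\<nu> + 1) (\<mu> + l + 2) k * of_real (\<zeta> \<alpha>) ^ k)"
      by (simp add: hyp_coeff_def)
  qed
  finally have 1: "(\<lambda>k. Gamma (l + 1) * (hyp_coeff (- \<nu>) (\<nu> + 1) (\<mu> + l + 2) k * of_real (\<zeta> \<alpha>) ^ k)) sums (LINT v:{0<..}|lborel. \<phi> v)" .
  have "(\<lambda>k. Gamma (l + 1) * (hyp_coeff (- \<nu>) (\<nu> + 1) (\<mu> + l + 2) k * of_real (\<zeta> \<alpha>) ^ k)) sums (Gamma (l + 1) * hyp2F1_reg (- \<nu>) (\<nu> + 1) (\<mu> + l + 2) (of_real (\<zeta> \<alpha>)))"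
    unfolding hyp2F1_reg_eq[of _ _ "\<mu> + l + 2"] using \<zeta>[of \<alpha>] by (intro sums_mult summable_sums hyp2F1_reg_summable) simp
  with 1 have LINT_\<phi>: "(LINT v:{0<..}|lborel. \<phi> v) = Gamma (l + 1) * hyp2F1_reg (- \<nu>) (\<nu> + 1) (\<mu> + l + 2) (of_real (\<zeta> \<alpha>))"
    by (rule sums_unique2)
  have cont_F: "continuous_on {z. norm z < 1} F"
    unfolding F_def by (intro continuous_at_imp_continuous_on ballI DERIV_isCont[OF has_field_derivative_hyp2F1_reg]) simp
  have cont_\<phi>: "continuous_on {0<..} \<phi>"
    unfolding \<phi>_def using small
    by (intro continuous_intros continuous_on_compose2[OF cont_F])
      (auto simp: complex_nonpos_Reals_iff complex_eq_iff)
  \<comment> \<open>The variable v of the overview, equal to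
    \<open>\<zeta> \<alpha> / \<zeta> s - 1\<close>, in a form that is easy to differentiate and
    invert.\<close>
  define g where "g s = (exp (2 * s) - exp (2 * \<alpha>)) * \<zeta> \<alpha>" for s
  define g' where "g' s = 2 * exp (2 * s) * \<zeta> \<alpha>" for s
  have img: "g ` {\<alpha><..} = {0<..}"
  proof (intro equalityI subsetI)
    fix v :: real assume v: "v \<in> {0<..}"
    define w where "w = v / \<zeta> \<alpha> + exp (2 * \<alpha>)"
    have w: "exp (2 * \<alpha>) < w" using v \<zeta>[of \<alpha>] by (simp add: w_def)
    then have w0: "0 < w" using exp_gt_zero[of "2 * \<alpha>"] by linarith
    have "2 * \<alpha> < ln w" using w w0 exp_less_cancel_iff[of "2 * \<alpha>" "ln w"] by simp
    moreover have "g (ln w / 2) = v" using w0 \<zeta>(1)[of \<alpha>] by (simp add: g_def w_def)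
    ultimately show "v \<in> g ` {\<alpha><..}" by (intro image_eqI[of _ _ "ln w / 2"]) auto
  qed (use \<zeta>(1)[of \<alpha>] in \<open>auto simp: g_def\<close>)
  \<comment> \<open>The factor depending on \<alpha> alone that the substitution leaves over. As
    \<open>2 * \<zeta> \<alpha>\<close> is e^(-\<alpha>) / cosh \<alpha>, it is also the prefactor
    of the hypergeometric function on the left side of the claim.\<close>
  define c where "c = complex_of_real (2 * \<zeta> \<alpha>) powr (\<mu> + l + 1)"
  have der: "(g has_field_derivative g' s) (at s)" for s
    unfolding g_def[abs_def] g'_def by (auto intro!: derivative_eq_intros)
  have g'_pos: "g' s > 0" for s using \<zeta>(1)[of \<alpha>] by (simp add: g'_def)
  have cont_g': "continuous_on {\<alpha><..} g'" unfolding g'_def by (intro continuous_intros)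
  note sub = set_integral_subst_Ioi[OF der g'_pos img cont_\<phi> cont_g' int_\<phi>]
  have eq: "c * (of_real (g' s) * \<phi> (g s)) = f s" if "s \<in> {\<alpha><..}" for s
  proof -
    have s: "\<alpha> < s" using that by simp
    have ratio: "1 + g s = \<zeta> \<alpha> / \<zeta> s"
      using e[of s] e[of \<alpha>] by (simp add: g_def \<zeta>_def field_simps)
    have g0: "g s > 0" using img that by blast
    have arg: "\<zeta> \<alpha> / (1 + g s) = \<zeta> s" unfolding ratio using \<zeta>(1)[of \<alpha>] by simp
    have tanh_diff: "tanh s - tanh \<alpha> = 2 * \<zeta> s * g s"
    proof -
      have "tanh s - tanh \<alpha> = 2 * \<zeta> s * (\<zeta> \<alpha> / \<zeta> s - 1)"
        using \<zeta>(1)[of s] by (simp add: tanh_real_alt \<zeta>_def[symmetric] divide_inverse) (simp add: \<zeta>_def field_simps)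
      then show ?thesis unfolding ratio[symmetric] by simp
    qed
    define L where "L = ln (2 * \<zeta> \<alpha>)"
    have ln_ratio: "ln (1 + g s) = L + s + ln (cosh s)"
    proof -
      have "1 + g s = (2 * \<zeta> \<alpha>) / (2 * \<zeta> s)" unfolding ratio by simp
      then have "ln (1 + g s) = ln (2 * \<zeta> \<alpha>) - ln (2 * \<zeta> s)" using \<zeta>(1)[of \<alpha>] \<zeta>(1)[of s] by (simp only:) (subst ln_div, auto)
      then show ?thesis unfolding ln_\<zeta> L_def by simp
    qed
    have g': "complex_of_real (g' s) = exp (2 * of_real s) * exp (of_real L)"
    proof -
      have "g' s = exp (2 * s) * exp L" using \<zeta>(1)[of \<alpha>] by (simp add: g'_def L_def)
      then show ?thesis by (simp only: of_real_mult exp_of_real[symmetric] of_real_numeral)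
    qed
    have P: "of_real (cosh s) powr (- \<mu> - 2) * ferrers_P \<nu> (- \<mu>) (tanh s) = exp ((- \<mu> - 2) * of_real (ln (cosh s)) - \<mu> * of_real s) * F (of_real (\<zeta> s))"
      unfolding F_def \<zeta>_def by (rule cosh_powr_ferrers_P)
    have c: "c = exp ((\<mu> + l + 1) * of_real L)"
      unfolding c_def L_def by (rule of_real_powr) (use \<zeta>(1)[of \<alpha>] in simp)
    have pw: "complex_of_real (1 + g s) powr w = exp (w * of_real (L + s + ln (cosh s)))" for w
      unfolding ln_ratio[symmetric] by (rule of_real_powr) (use g0 in simp)
    \<comment> \<open>With all powers as exponentials the claim is linear in the exponents: L
      cancels, and the surplus e^(-l (s + ln (cosh s))) is \<open>2 * \<zeta> s\<close> to the power
      l, which joins \<open>g s\<close> to form the power of tanh s - tanh \<alpha>.\<close>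
    have "c * (of_real (g' s) * \<phi> (g s)) = (exp ((\<mu> + l + 1) * of_real L) * exp (2 * of_real s) * exp (of_real L) * exp (- (\<mu> + l + 2) * of_real (L + s + ln (cosh s)))) * F (of_real (\<zeta> s)) * of_real (g s) powr l"
      unfolding \<phi>_def arg g' c pw by (simp only: mult_ac)
    also have "exp ((\<mu> + l + 1) * of_real L) * exp (2 * of_real s) * exp (of_real L) * exp (- (\<mu> + l + 2) * of_real (L + s + ln (cosh s)))
      = exp ((- \<mu> - 2) * of_real (ln (cosh s)) - \<mu> * of_real s) * exp (l * of_real (- s - ln (cosh s)))"
      unfolding exp_add[symmetric] by (rule arg_cong[where f = exp]) (simp add: algebra_simps)
    also have "exp (l * of_real (- s - ln (cosh s))) = of_real (2 * \<zeta> s) powr l"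
      using \<zeta>(1)[of s] by (subst of_real_powr) (auto simp: ln_\<zeta>)
    finally show ?thesis unfolding f_def P tanh_diff
      using g0 \<zeta>(1)[of s] by (simp add: powr_times_real mult_ac)
  qed
  have "set_integrable lborel {\<alpha><..} (\<lambda>s. c * (of_real (g' s) * \<phi> (g s)))"
    by (intro set_integrable_mult_right sub(1))
  then show "set_integrable lborel {\<alpha><..} f"
    by (subst (asm) set_integrable_cong[OF refl refl eq]) auto
  have "(LINT s:{\<alpha><..}|lborel. f s) = (LINT s:{\<alpha><..}|lborel. c * (of_real (g' s) * \<phi> (g s)))"
    by (rule set_lebesgue_integral_cong) (use eq in auto)
  also have "\<dots> = c * (Gamma (l + 1) * hyp2F1_reg (- \<nu>) (\<nu> + 1) (\<mu> + l + 2) (of_real (\<zeta> \<alpha>)))"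
    unfolding set_integral_mult_right sub(2) LINT_\<phi> ..
  finally have I: "(LINT s:{\<alpha><..}|lborel. f s) = c * (Gamma (l + 1) * hyp2F1_reg (- \<nu>) (\<nu> + 1) (\<mu> + l + 2) (of_real (\<zeta> \<alpha>)))" .
  have "l + 1 \<notin> \<int>\<^sub>\<le>\<^sub>0" using l by (auto elim!: nonpos_Ints_cases simp: complex_eq_iff)
  then have Gl: "Gamma (l + 1) \<noteq> 0" by (simp add: Gamma_eq_zero_iff)
  have "ferrers_P \<nu> (- \<mu> - l - 1) (tanh \<alpha>) / of_real (cosh \<alpha>) powr (\<mu> + l + 1)
     = of_real (cosh \<alpha>) powr (- (\<mu> + l + 1)) * ferrers_P \<nu> (- (\<mu> + l + 1)) (tanh \<alpha>)"
  proof -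
    have "- \<mu> - l - 1 = - (\<mu> + l + 1)" by simp
    then show ?thesis by (simp only: powr_minus divide_inverse mult.commute)
  qed
  also have "\<dots> = exp (- (\<mu> + l + 1) * of_real (ln (cosh \<alpha>)) - (\<mu> + l + 1) * of_real \<alpha>) * hyp2F1_reg (- \<nu>) (\<nu> + 1) (1 + (\<mu> + l + 1)) (of_real (\<zeta> \<alpha>))"
    unfolding \<zeta>_def by (rule cosh_powr_ferrers_P)
  also have "1 + (\<mu> + l + 1) = \<mu> + l + 2" by simp
  also have "exp (- (\<mu> + l + 1) * of_real (ln (cosh \<alpha>)) - (\<mu> + l + 1) * of_real \<alpha>) = c"
  proof -
    have pos: "0 < 2 * \<zeta> \<alpha>" using \<zeta>(1)[of \<alpha>] by simp
    show ?thesis unfolding c_def of_real_powr[OF pos] ln_\<zeta>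
      by (rule arg_cong[where f = exp]) (simp add: algebra_simps)
  qed
  finally show "ferrers_P \<nu> (- \<mu> - l - 1) (tanh \<alpha>) / of_real (cosh \<alpha>) powr (\<mu> + l + 1) =
       1 / Gamma (l + 1) * (LINT s:{\<alpha><..}|lborel. f s)"
    unfolding I using Gl by simp
qed

theorem theorem7:
  fixes \<alpha> :: real
  shows
    "(\<forall>l \<rho> \<mu> :: complex. Re (\<mu> - \<rho>) > Re l + 1 \<and> Re l + 1 > 0 \<longrightarrow>
       set_integrable lborel {\<alpha><..}
         (\<lambda>s. ferrers_P \<rho> (- \<mu>) (tanh s) * complex_of_real (cosh s) powr (\<rho> + 1) *
              complex_of_real (sinh s - sinh \<alpha>) powr l) \<and>
       complex_of_real (cosh \<alpha>) powr (l + \<rho> + 1) *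
         ferrers_P (l + \<rho> + 1) (- \<mu>) (tanh \<alpha>) =
       Gamma (\<mu> - \<rho>) / (Gamma (1 + l) * Gamma (\<mu> - l - \<rho> - 1)) *
       (LINT s:{\<alpha><..}|lborel.
          ferrers_P \<rho> (- \<mu>) (tanh s) * complex_of_real (cosh s) powr (\<rho> + 1) *
          complex_of_real (sinh s - sinh \<alpha>) powr l)) \<and>
    (\<forall>l \<mu> \<nu> :: complex. Re \<mu> > -1 \<and> Re l > -1 \<longrightarrow>
       set_integrable lborel {\<alpha><..}
         (\<lambda>s. complex_of_real (cosh s) powr (- \<mu> - 2) * ferrers_P \<nu> (- \<mu>) (tanh s) *
              complex_of_real (tanh s - tanh \<alpha>) powr l) \<and>
       ferrers_P \<nu> (- \<mu> - l - 1) (tanh \<alpha>) / complex_of_real (cosh \<alpha>) powr (\<mu> + l + 1) =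
       1 / Gamma (l + 1) *
       (LINT s:{\<alpha><..}|lborel.
          complex_of_real (cosh s) powr (- \<mu> - 2) * ferrers_P \<nu> (- \<mu>) (tanh s) *
          complex_of_real (tanh s - tanh \<alpha>) powr l))"
  by (intro conjI allI impI; elim conjE; rule ferrers_weyl_integral ferrers_tanh_integral; assumption)

end
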